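(* Let $k,n$ be integers with $n\ge 2$ and $3\le k\le n+1$. If every plausible $\tau$-parity for $(k,n)$ is actual for $(k,n)$, then there exists $N_0$ such that for all integers $N\ge N_0$, every plausible $\tau$-parity for $(k,N)$ is actual for $(k,N)$.
   Context: An orthogonal array $\mathrm{OA}(k,n)$ on an alphabet $\Lambda$ with $|\Lambda|=n$ is an $n^2\times k$ matrix $A=(a_{r\ell})$ with entries in $\Lambda$ such that in every pair of distinct columns each ordered pair in $\Lambda^2$ occurs in exactly one row. For distinct columns $c,i,j\in\{1,\dots,k\}$ and $s\in\Lambda$, let $\rho_s(c,i,j)$ be the permutation of $\Lambda$ mapping $a_{ri}\mapsto a_{rj}$ for all rows $r$ with $a_{rc}=s$. With $\pi(\gamma)\in\mathbb{Z}_2$ denoting the parity of a permutation $\gamma$ ($0$ for even, $1$ for odd), define $\tau^c_{ij}(A)=\sum_{s\in\Lambda}\pi(\rho_s(c,i,j))\in\mathbb{Z}_2$. The $\tau$-parity of $A$ is the vector $(\tau^c_{ij}(A))$ indexed by the ordered triples $(c,i,j)$ of distinct elements of $\{1,\dots,k\}$. A plausible $\tau$-parity for $(k,n)$ is any $\mathbb{Z}_2$-vector $(\tau^c_{ij})$ indexed by the ordered triples $(c,i,j)$ of distinct elements of $\{1,\dots,k\}$ such that, in $\mathbb{Z}_2$: (1) $\tau^c_{ij}=\tau^c_{ji}$ for all distinct $c,i,j$; (2) $\tau^c_{ij}=\tau^c_{i\ell}+\tau^c_{\ell j}$ for all distinct $c,i,j,\ell$; (3) $\tau^c_{ij}+\tau^i_{cj}+\tau^j_{ci}=\binom{n}{2}$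 for all distinct $c,i,j$. It is actual for $(k,n)$ if it is the $\tau$-parity of some $\mathrm{OA}(k,n)$. *)

theory Defs
  imports "HOL-Combinatorics.Permutations" "HOL-Library.Z2"
begin

text \<open>
  Matrices are functions of a row index in \<open>{1..n\<^sup>2}\<close> and a column index in \<open>{1..k}\<close>; values
  outside these ranges are irrelevant. The field \<open>\<int>\<^sub>2\<close> is the type \<^typ>\<open>bit\<close>.
\<close>

definition orthogonal_array :: "nat \<Rightarrow> nat \<Rightarrow> 'a set \<Rightarrow> (nat \<Rightarrow> nat \<Rightarrow> 'a) \<Rightarrow> bool" where
  "orthogonal_array k n L A \<longleftrightarrow>
     finite L \<and> card L = n \<and>
     (\<forall>r\<in>{1..n^2}. \<forall>l\<in>{1..k}. A r l \<in> L) \<and>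
     (\<forall>i\<in>{1..k}. \<forall>j\<in>{1..k}. i \<noteq> j \<longrightarrow>
        (\<forall>x\<in>L. \<forall>y\<in>L. \<exists>!r. r \<in> {1..n^2} \<and> A r i = x \<and> A r j = y))"

text \<open>
  For an orthogonal array, distinct columns \<open>c\<close>, \<open>i\<close>, \<open>j\<close> and \<open>s \<in> L\<close>, the rows with entry \<open>s\<close> in
  column \<open>c\<close> contain every symbol exactly once in each of the columns \<open>i\<close> and \<open>j\<close>, so the
  description is unique (\<open>permutes\<close> fixes everything outside \<open>L\<close>).
\<close>
definition row_perm ::
    "nat \<Rightarrow> 'a set \<Rightarrow> (nat \<Rightarrow> nat \<Rightarrow> 'a) \<Rightarrow> 'a \<Rightarrow> nat \<Rightarrow> nat \<Rightarrow> nat \<Rightarrow> 'a \<Rightarrow> 'a" where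
  "row_perm n L A s c i j =
     (THE p. p permutes L \<and> (\<forall>r\<in>{1..n^2}. A r c = s \<longrightarrow> p (A r i) = A r j))"

definition perm_parity :: "('a \<Rightarrow> 'a) \<Rightarrow> bit" where
  "perm_parity p = (if evenperm p then 0 else 1)"

definition tau_parity ::
    "nat \<Rightarrow> 'a set \<Rightarrow> (nat \<Rightarrow> nat \<Rightarrow> 'a) \<Rightarrow> nat \<Rightarrow> nat \<Rightarrow> nat \<Rightarrow> bit" where
  "tau_parity n L A c i j = (\<Sum>s\<in>L. perm_parity (row_perm n L A s c i j))"

text \<open>
  A vector indexed by the ordered triples of distinct elements of \<open>{1..k}\<close> is a function
  \<open>t c i j\<close> of which only the values at such triples matter.
\<close>

definition plausible :: "nat \<Rightarrow> nat \<Rightarrow> (nat \<Rightarrow> nat \<Rightarrow> nat \<Rightarrow> bit) \<Rightarrow> bool" where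
  "plausible k n t \<longleftrightarrow>
     (\<forall>c\<in>{1..k}. \<forall>i\<in>{1..k}. \<forall>j\<in>{1..k}. distinct [c, i, j] \<longrightarrow>
        t c i j = t c j i) \<and>
     (\<forall>c\<in>{1..k}. \<forall>i\<in>{1..k}. \<forall>j\<in>{1..k}. \<forall>l\<in>{1..k}. distinct [c, i, j, l] \<longrightarrow>
        t c i j = t c i l + t c l j) \<and>
     (\<forall>c\<in>{1..k}. \<forall>i\<in>{1..k}. \<forall>j\<in>{1..k}. distinct [c, i, j] \<longrightarrow>
        t c i j + t i c j + t j c i = of_nat (n choose 2))"

text \<open>
  Every finite alphabet is in bijection with a set of natural numbers, and renaming symbols
  conjugates the permutations and so preserves parities: alphabets in \<^typ>\<open>nat\<close> suffice.
\<close>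
definition actual :: "nat \<Rightarrow> nat \<Rightarrow> (nat \<Rightarrow> nat \<Rightarrow> nat \<Rightarrow> bit) \<Rightarrow> bool" where
  "actual k n t \<longleftrightarrow>
     (\<exists>(L :: nat set) A. orthogonal_array k n L A \<and>
        (\<forall>c\<in>{1..k}. \<forall>i\<in>{1..k}. \<forall>j\<in>{1..k}. distinct [c, i, j] \<longrightarrow>
           tau_parity n L A c i j = t c i j))"

end

theory Submission
  imports Defs "HOL-Number_Theory.Number_Theory" "HOL-Computational_Algebra.Polynomial"
begin

text \<open>
  For all large \<open>N\<close> there is an \<open>OA(k,N)\<close> containing an \<open>OA(k,n)\<close> on a subset of its symbols and
  rows. Exchanging the subarray for another one on the same symbols adds the difference of the two
  subarray parities to the \<open>\<tau>\<close>-parity. Plausible vectors form an affine space whose direction depends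
  on \<open>k\<close> only, so the required difference is one between plausible vectors for \<open>(k,n)\<close>, all of which
  are actual.

  The large arrays come from Wilson's construction: \<open>OA(k+1,t)\<close>, \<open>OA(k,m)\<close>, \<open>OA(k,m+1)\<close> and
  \<open>OA(k,u)\<close> with \<open>u < t\<close> give an \<open>OA(k,mt+u)\<close> containing the \<open>OA(k,m)\<close>. As in the theorem of Chowla,
  Erdos and Straus, \<open>m = 2^a - 1\<close> is chosen congruent to \<open>1\<close> modulo every prime up to \<open>k\<close>; then
  orders coprime to \<open>k!\<close> handle all large even \<open>N\<close>, and these handle the odd ones. A last application
  with \<open>m\<close> a multiple of \<open>n\<close> provides the subarray.
\<close>

section \<open>Relative parity of two bijections\<close>

lemma bit_eq_iff_add_eq_0: "(a::bit) = b \<longleftrightarrow> a + b = 0"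
  by (cases a; cases b) auto

lemma bit_add_self [simp]: "(a::bit) + a = 0"
  by (cases a) auto

lemma bit_add_left_self [simp]: "(a::bit) + (a + b) = b"
  by (cases a; cases b) auto

lemma perm_parity_compose:
  "permutation p \<Longrightarrow> permutation q \<Longrightarrow> perm_parity (p \<circ> q) = perm_parity p + perm_parity q"
  by (auto simp: perm_parity_def evenperm_comp)

lemma perm_parity_id [simp]: "perm_parity id = 0"
  by (simp add: perm_parity_def)

text \<open>Rows are an unordered index set, but two bijections of \<open>R\<close> onto the same
  \<open>X\<close> have a quotient, the permutation \<open>e r \<mapsto> f r\<close> of
  \<open>X\<close>, and its parity is meaningful. \<open>restrict_id\<close> extends it by the
  identity, as \<open>permutes\<close> demands.\<close>

definition bij_parity :: "'r set \<Rightarrow> 'x set \<Rightarrow> ('r \<Rightarrow> 'x) \<Rightarrow> ('r \<Rightarrow> 'x) \<Rightarrow> bit" where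
  "bij_parity R X e f = perm_parity (restrict_id (f \<circ> inv_into R e) X)"

lemma permutes_bij_quotient:
  assumes "bij_betw e R X" "bij_betw f R X"
  shows "restrict_id (f \<circ> inv_into R e) X permutes X"
  by (intro permutes_restrict_id bij_betw_trans[OF bij_betw_inv_into[OF assms(1)] assms(2)])

lemma bij_quotient_apply:
  assumes "bij_betw e R X" "r \<in> R"
  shows "restrict_id (f \<circ> inv_into R e) X (e r) = f r"
  using assms by (auto simp: bij_betw_def)

lemma bij_quotient_unique:
  assumes "bij_betw e R X" "p permutes X" "\<And>r. r \<in> R \<Longrightarrow> p (e r) = f r"
  shows "p = restrict_id (f \<circ> inv_into R e) X"
proof
  fix x
  show "p x = restrict_id (f \<circ> inv_into R e) X x"
  proof (cases "x \<in> X")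
    case True
    then obtain r where "r \<in> R" "x = e r" using assms(1) by (auto simp: bij_betw_def)
    then show ?thesis using bij_quotient_apply[OF assms(1), of r f] assms(3) by simp
  next
    case False
    then show ?thesis using assms(2) by (simp add: permutes_not_in)
  qed
qed

text \<open>Parities are computed below by exhibiting a permutation of \<open>X\<close> that carries
  \<open>e\<close> to \<open>f\<close>; uniqueness makes it the quotient.\<close>

lemma bij_parity_eqI:
  assumes "bij_betw e R X" "p permutes X" "\<And>r. r \<in> R \<Longrightarrow> p (e r) = f r"
  shows "bij_parity R X e f = perm_parity p"
  unfolding bij_parity_def using bij_quotient_unique[of e R X p f] assms by simp

lemma bij_parity_refl: "bij_betw e R X \<Longrightarrow> bij_parity R X e e = 0"
  using bij_parity_eqI[of e R X id e] by simp

lemma bij_parity_trans: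
  assumes "finite X" "bij_betw e R X" "bij_betw f R X" "bij_betw g R X"
  shows "bij_parity R X e f + bij_parity R X f g = bij_parity R X e g"
proof -
  let ?p = "restrict_id (f \<circ> inv_into R e) X" and ?q = "restrict_id (g \<circ> inv_into R f) X"
  have pq: "?p permutes X" "?q permutes X" by (intro permutes_bij_quotient assms)+
  have "bij_parity R X e g = perm_parity (?q \<circ> ?p)"
    using assms pq bij_quotient_apply[OF assms(2), of _ f] bij_quotient_apply[OF assms(3), of _ g]
    by (intro bij_parity_eqI permutes_compose) simp_all
  also have "\<dots> = perm_parity ?q + perm_parity ?p"
    using pq assms(1) by (intro perm_parity_compose permutes_imp_permutation)
  finally show ?thesis by (simp only: bij_parity_def add.commute)
qed

lemma bij_parity_sym:
  assumes "finite X" "bij_betw e R X" "bij_betw f R X"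
  shows "bij_parity R X e f = bij_parity R X f e"
  using bij_parity_trans[of X e R f e] bij_parity_refl[of e R X] assms
  by (metis bit_eq_iff_add_eq_0)

text \<open>Renaming the values by \<open>h\<close> conjugates the quotient permutation.\<close>

lemma bij_parity_comp:
  assumes "finite X" "bij_betw e R X" "bij_betw f R X" "bij_betw h X Y"
  shows "bij_parity R Y (h \<circ> e) (h \<circ> f) = bij_parity R X e f"
proof -
  let ?p = "restrict_id (f \<circ> inv_into R e) X"
  have p: "?p permutes X" by (intro permutes_bij_quotient assms)
  have inj: "inj_on h X" using assms(4) by (simp add: bij_betw_def)
  have "bij_parity R Y (h \<circ> e) (h \<circ> f) = perm_parity (map_permutation X h ?p)"
  proof (rule bij_parity_eqI)
    show "bij_betw (h \<circ> e) R Y" using assms bij_betw_trans by blast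
    show "map_permutation X h ?p permutes Y" by (rule map_permutation_permutes[OF assms(4) p])
    fix r assume "r \<in> R"
    then show "map_permutation X h ?p ((h \<circ> e) r) = (h \<circ> f) r"
      using map_permutation_apply[OF inj, of "e r" ?p] assms(2) bij_quotient_apply[OF assms(2), of r f]
      by (auto simp: bij_betwE)
  qed
  also have "\<dots> = perm_parity ?p"
    using evenperm_map_permutation[OF inj p assms(1)] by (simp add: perm_parity_def)
  finally show ?thesis by (simp add: bij_parity_def)
qed

lemma bij_parity_reindex:
  assumes "bij_betw e R X" "bij_betw f R X" "bij_betw g Q R"
  shows "bij_parity Q X (e \<circ> g) (f \<circ> g) = bij_parity R X e f"
proof -
  let ?p = "restrict_id (f \<circ> inv_into R e) X"
  have "bij_parity Q X (e \<circ> g) (f \<circ> g) = perm_parity ?p"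
  proof (rule bij_parity_eqI)
    show "bij_betw (e \<circ> g) Q X" using assms bij_betw_trans by blast
    show "?p permutes X" by (intro permutes_bij_quotient assms)
    fix r assume "r \<in> Q"
    then have "g r \<in> R" using assms(3) by (auto simp: bij_betw_def)
    then show "?p ((e \<circ> g) r) = (f \<circ> g) r"
      using bij_quotient_apply[OF assms(1), of "g r" f] by simp
  qed
  then show ?thesis by (simp add: bij_parity_def)
qed

text \<open>The quotient is the product of the quotients on \<open>X\<close> and \<open>Y\<close>,
  each fixing the other set pointwise.\<close>

lemma bij_parity_Un:
  assumes "finite X" "finite Y" "X \<inter> Y = {}"
    and "bij_betw e Q X" "bij_betw f Q X" "bij_betw e R Y" "bij_betw f R Y"
  shows "bij_parity (Q \<union> R) (X \<union> Y) e f = bij_parity Q X e f + bij_parity R Y e f"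
proof -
  let ?p = "restrict_id (f \<circ> inv_into Q e) X" and ?q = "restrict_id (f \<circ> inv_into R e) Y"
  have p: "?p permutes X" and q: "?q permutes Y" by (intro permutes_bij_quotient assms)+
  have "bij_parity (Q \<union> R) (X \<union> Y) e f = perm_parity (?p \<circ> ?q)"
  proof (rule bij_parity_eqI)
    show "bij_betw e (Q \<union> R) (X \<union> Y)" using assms by (simp add: bij_betw_combine)
    show "?p \<circ> ?q permutes X \<union> Y"
      by (meson p q permutes_compose permutes_subset sup_ge1 sup_ge2)
    fix r assume "r \<in> Q \<union> R"
    moreover have "(?p \<circ> ?q) (e r) = f r" if r: "r \<in> Q"
    proof -
      have "e r \<in> X" using r assms(4) by (auto simp: bij_betw_def)
      then have "?q (e r) = e r" using assms(3) by (intro restrict_id_simps) auto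
      then show ?thesis using bij_quotient_apply[OF assms(4) r, of f] by simp
    qed
    moreover have "(?p \<circ> ?q) (e r) = f r" if r: "r \<in> R"
    proof -
      have "f r \<in> Y" using r assms(7) by (auto simp: bij_betw_def)
      then have "?p (f r) = f r" using assms(3) by (intro restrict_id_simps) auto
      then show ?thesis using bij_quotient_apply[OF assms(6) r, of f] by simp
    qed
    ultimately show "(?p \<circ> ?q) (e r) = f r" by blast
  qed
  then show ?thesis
    using p q assms(1,2)
    by (simp only: perm_parity_compose permutes_imp_permutation bij_parity_def)
qed

lemma bij_parity_empty [simp]: "bij_parity {} {} e f = 0"
  by (subst bij_parity_eqI[where p = id]) (auto simp: bij_betw_def)

lemma bij_parity_UN:
  assumes "finite I" "\<And>s. s \<in> I \<Longrightarrow> finite (X s)"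
    and "\<And>s t. s \<in> I \<Longrightarrow> t \<in> I \<Longrightarrow> s \<noteq> t \<Longrightarrow> X s \<inter> X t = {}"
    and "\<And>s. s \<in> I \<Longrightarrow> bij_betw e (R s) (X s)" "\<And>s. s \<in> I \<Longrightarrow> bij_betw f (R s) (X s)"
  shows "bij_parity (\<Union>s\<in>I. R s) (\<Union>s\<in>I. X s) e f = (\<Sum>s\<in>I. bij_parity (R s) (X s) e f)"
  using assms
proof (induction I rule: finite_induct)
  case (insert a F)
  have bij: "bij_betw h (\<Union>s\<in>F. R s) (\<Union>s\<in>F. X s)" if "\<And>s. s \<in> insert a F \<Longrightarrow> bij_betw h (R s) (X s)" for h
  proof -
    have "disjoint_family_on X F" 
      using insert.prems(2) by (auto simp: disjoint_family_on_def)
    then show ?thesis using that by (intro bij_betw_UNION_disjoint) auto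
  qed
  have "bij_parity (R a \<union> (\<Union>s\<in>F. R s)) (X a \<union> (\<Union>s\<in>F. X s)) e f =
      bij_parity (R a) (X a) e f + bij_parity (\<Union>s\<in>F. R s) (\<Union>s\<in>F. X s) e f"
  proof (rule bij_parity_Un)
    show "X a \<inter> (\<Union>s\<in>F. X s) = {}" using insert.prems(2)[of a] insert.hyps(2) by fastforce
  qed (use insert in \<open>auto intro!: bij\<close>)
  then show ?case using insert by simp
qed simp

text \<open>The swap fixes the diagonal and splits the rest into 2-cycles, one for each unordered
  pair. A new symbol \<open>a\<close> adds \<open>card F\<close> of them and the fixed point
  \<open>(a, a)\<close>.\<close>

lemma bij_parity_swap:
  assumes "finite L"
  shows "bij_parity (L \<times> L) (L \<times> L) id prod.swap = of_nat (card L choose 2)"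
  using assms
proof (induction L rule: finite_induct)
  case (insert a F)
  let ?X = "\<Union>x\<in>F. {(a, x), (x, a)}"
  have sw: "bij_betw prod.swap (F \<times> F) (F \<times> F)"
    by (rule bij_betw_byWitness[where f' = prod.swap]) auto
  have one: "bij_parity {(a, x), (x, a)} {(a, x), (x, a)} id prod.swap = 1" if "x \<in> F" for x
  proof -
    have "bij_parity {(a, x), (x, a)} {(a, x), (x, a)} id prod.swap =
        perm_parity (transpose (a, x) (x, a))"
      by (rule bij_parity_eqI) (auto simp: permutes_swap_id)
    also have "\<dots> = 1" using that insert.hyps by (auto simp: perm_parity_def evenperm_swap)
    finally show ?thesis .
  qed
  have bX: "bij_betw prod.swap {(a, x), (x, a)} {(a, x), (x, a)}" for x
    by (rule bij_betw_byWitness[where f' = prod.swap]) auto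
  have X: "bij_parity ?X ?X id prod.swap = of_nat (card F)"
  proof -
    have "bij_parity ?X ?X id prod.swap =
        (\<Sum>x\<in>F. bij_parity {(a, x), (x, a)} {(a, x), (x, a)} id prod.swap)"
      by (rule bij_parity_UN) (use insert.hyps bX in auto)
    also have "\<dots> = of_nat (card F)" using one by simp
    finally show ?thesis .
  qed
  have bX': "bij_betw prod.swap ?X ?X"
    by (rule bij_betw_byWitness[where f' = prod.swap]) auto
  have e: "insert a F \<times> insert a F = (F \<times> F \<union> ?X) \<union> {(a, a)}" by auto
  have "bij_parity (insert a F \<times> insert a F) (insert a F \<times> insert a F) id prod.swap =
     bij_parity (F \<times> F \<union> ?X) (F \<times> F \<union> ?X) id prod.swap + bij_parity {(a,a)} {(a,a)} id prod.swap"
    unfolding e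
    by (rule bij_parity_Un)
       (use insert.hyps sw bX' in \<open>auto intro!: bij_betw_combine simp: bij_betw_id\<close>)
  also have "bij_parity {(a,a)} {(a,a)} id prod.swap = 0"
    using bij_parity_eqI[of id "{(a,a)}" "{(a,a)}" id prod.swap] by simp
  also have "bij_parity (F \<times> F \<union> ?X) (F \<times> F \<union> ?X) id prod.swap =
      bij_parity (F \<times> F) (F \<times> F) id prod.swap + bij_parity ?X ?X id prod.swap"
    by (rule bij_parity_Un) (use insert.hyps sw bX' in \<open>auto simp: bij_betw_id\<close>)
  finally have "bij_parity (insert a F \<times> insert a F) (insert a F \<times> insert a F) id prod.swap =
      of_nat ((card F choose 2) + card F)"
    by (simp only: insert.IH X of_nat_add add_0_right)
  also have "(card F choose 2) + card F = card (insert a F) choose 2"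
    using insert.hyps by (simp add: numeral_2_eq_2)
  finally show ?case .
next
  case empty
  have "card ({} :: 'a set) choose 2 = 0" by simp
  then show ?case by (simp only: of_nat_0 bij_parity_empty Sigma_empty1)
qed

lemma bij_parity_cong:
  assumes "bij_betw e R X" "bij_betw f R X"
    and "\<And>r. r \<in> R \<Longrightarrow> e' r = e r" "\<And>r. r \<in> R \<Longrightarrow> f' r = f r"
  shows "bij_parity R X e' f' = bij_parity R X e f"
proof -
  have "bij_parity R X e' f' = perm_parity (restrict_id (f \<circ> inv_into R e) X)"
  proof (rule bij_parity_eqI)
    show "bij_betw e' R X" using assms(1,3) bij_betw_cong[of R e' e X] by simp
    show "restrict_id (f \<circ> inv_into R e) X permutes X"
      by (rule permutes_bij_quotient[OF assms(1,2)])
    show "restrict_id (f \<circ> inv_into R e) X (e' r) = f' r" if "r \<in> R" for r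
      using that assms(3,4) bij_quotient_apply[OF assms(1), of r f] by simp
  qed
  then show ?thesis by (simp only: bij_parity_def)
qed

section \<open>Orthogonal arrays with indexed rows\<close>

text \<open>Rows form an arbitrary set, so that subarrays, products and disjoint unions need no
  numbering. That entries lie in \<open>L\<close> follows from the bijections once there are two
  columns, hence \<open>2 \<le> k\<close> in many lemmas.\<close>

definition oa :: "nat \<Rightarrow> 'a set \<Rightarrow> 'r set \<Rightarrow> ('r \<Rightarrow> nat \<Rightarrow> 'a) \<Rightarrow> bool" where
  "oa k L R A \<longleftrightarrow> finite L \<and>
     (\<forall>i\<in>{1..k}. \<forall>j\<in>{1..k}. i \<noteq> j \<longrightarrow> bij_betw (\<lambda>r. (A r i, A r j)) R (L \<times> L))"

lemma oa_finite: "oa k L R A \<Longrightarrow> finite L"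
  by (simp add: oa_def)

lemma oa_bij:
  "oa k L R A \<Longrightarrow> i \<in> {1..k} \<Longrightarrow> j \<in> {1..k} \<Longrightarrow> i \<noteq> j \<Longrightarrow>
    bij_betw (\<lambda>r. (A r i, A r j)) R (L \<times> L)"
  by (simp add: oa_def)

lemma oa_entry:
  assumes "oa k L R A" "2 \<le> k" "i \<in> {1..k}" "r \<in> R"
  shows "A r i \<in> L"
proof -
  obtain j where "j \<in> {1..k}" "i \<noteq> j"
    using assms(2) that[of 1] that[of 2] by fastforce
  then have "(A r i, A r j) \<in> L \<times> L"
    using oa_bij[OF assms(1,3)] assms(4) by (meson bij_betwE)
  then show ?thesis by simp
qed

lemma oa_row:
  assumes "oa k L R A" "i \<in> {1..k}" "j \<in> {1..k}" "i \<noteq> j" "x \<in> L" "y \<in> L"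
  obtains r where "r \<in> R" "A r i = x" "A r j = y"
proof -
  have "(x, y) \<in> (\<lambda>r. (A r i, A r j)) ` R"
    using oa_bij[OF assms(1-4)] assms(5,6) by (simp add: bij_betw_def)
  then show thesis using that by auto
qed

lemma oa_row_unique:
  assumes "oa k L R A" "i \<in> {1..k}" "j \<in> {1..k}" "i \<noteq> j" "r \<in> R" "s \<in> R"
    "A r i = A s i" "A r j = A s j"
  shows "r = s"
  using oa_bij[OF assms(1-4)] assms(5-8) by (auto simp: bij_betw_def dest: inj_onD)

lemma oa_card_rows:
  assumes "oa k L R A" "2 \<le> k"
  shows "card R = card L ^ 2" "finite R"
proof -
  have b: "bij_betw (\<lambda>r. (A r 1, A r 2)) R (L \<times> L)"
    using assms by (intro oa_bij) auto
  show "card R = card L ^ 2"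
    using bij_betw_same_card[OF b] by (simp add: card_cartesian_product power2_eq_square)
  show "finite R" using bij_betw_finite[OF b] oa_finite[OF assms(1)] by simp
qed

lemma orthogonal_array_iff_oa:
  assumes "2 \<le> k"
  shows "orthogonal_array k n L A \<longleftrightarrow> card L = n \<and> oa k L {1..n^2} A"
proof
  assume oA: "orthogonal_array k n L A"
  have "bij_betw (\<lambda>r. (A r i, A r j)) {1..n^2} (L \<times> L)"
    if ij: "i \<in> {1..k}" "j \<in> {1..k}" "i \<noteq> j" for i j
  proof -
    have ex: "\<And>x y. x \<in> L \<Longrightarrow> y \<in> L \<Longrightarrow> \<exists>!r. r \<in> {1..n^2} \<and> A r i = x \<and> A r j = y"
      and en: "\<And>r. r \<in> {1..n^2} \<Longrightarrow> A r i \<in> L \<and> A r j \<in> L"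
      using oA ij unfolding orthogonal_array_def by blast+
    show ?thesis
    proof (rule bij_betw_imageI)
      show "inj_on (\<lambda>r. (A r i, A r j)) {1..n^2}"
      proof (rule inj_onI)
        fix r s assume rs: "r \<in> {1..n^2}" "s \<in> {1..n^2}" "(A r i, A r j) = (A s i, A s j)"
        then show "r = s" using ex[of "A r i" "A r j"] en[of r] by auto
      qed
      show "(\<lambda>r. (A r i, A r j)) ` {1..n^2} = L \<times> L"
      proof (intro equalityI subsetI)
        fix z assume "z \<in> L \<times> L"
        then obtain r where "r \<in> {1..n^2}" "A r i = fst z" "A r j = snd z"
          using ex[of "fst z" "snd z"] by auto
        then show "z \<in> (\<lambda>r. (A r i, A r j)) ` {1..n^2}"
          by (intro image_eqI[of _ _ r]) auto
      qed (use en in auto)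
    qed
  qed
  with oA show "card L = n \<and> oa k L {1..n^2} A" by (auto simp: oa_def orthogonal_array_def)
next
  assume A: "card L = n \<and> oa k L {1..n^2} A"
  then have o: "oa k L {1..n^2} A" by blast
  have "\<exists>!r. r \<in> {1..n^2} \<and> A r i = x \<and> A r j = y"
    if ij: "i \<in> {1..k}" "j \<in> {1..k}" "i \<noteq> j" and "x \<in> L" "y \<in> L" for i j x y
    using oa_row[OF o ij that(4,5)] oa_row_unique[OF o ij] by metis
  then show "orthogonal_array k n L A"
    using A oa_entry[OF o assms] by (auto simp: orthogonal_array_def oa_def)
qed

text \<open>
  For \<open>s \<in> L\<close>, the permutation \<open>(A r c, A r i) \<mapsto> (A r c, A r j)\<close> of \<open>L \<times> L\<close> acts on \<open>{s} \<times> L\<close> as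
  \<open>\<rho>\<^sub>s(c,i,j)\<close>, so its parity is the sum over \<open>s\<close>.
\<close>
definition tau :: "'a set \<Rightarrow> 'r set \<Rightarrow> ('r \<Rightarrow> nat \<Rightarrow> 'a) \<Rightarrow> nat \<Rightarrow> nat \<Rightarrow> nat \<Rightarrow> bit" where
  "tau L R A c i j = bij_parity R (L \<times> L) (\<lambda>r. (A r c, A r i)) (\<lambda>r. (A r c, A r j))"

lemma tau_parity_eq_tau:
  assumes o: "oa k L {1..n^2} A" and cij: "c \<in> {1..k}" "i \<in> {1..k}" "j \<in> {1..k}" "distinct [c, i, j]"
  shows "tau_parity n L A c i j = tau L {1..n^2} A c i j"
proof -
  let ?R = "\<lambda>s. {r \<in> {1..n^2}. A r c = s}"
  have fin: "finite L" using o by (rule oa_finite)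
  have b: "bij_betw (\<lambda>r. (A r c, A r l)) (?R s) ({s} \<times> L)"
    if sl: "s \<in> L" "l \<in> {1..k}" "c \<noteq> l" for s l
  proof -
    have bl: "bij_betw (\<lambda>r. (A r c, A r l)) {1..n^2} (L \<times> L)" by (rule oa_bij[OF o cij(1) sl(2,3)])
    show ?thesis
    proof (rule bij_betw_subset[OF bl])
      show "(\<lambda>r. (A r c, A r l)) ` ?R s = {s} \<times> L"
      proof (intro equalityI subsetI)
        fix z assume "z \<in> {s} \<times> L"
        then have z: "fst z = s" "snd z \<in> L" by auto
        obtain r where "r \<in> {1..n^2}" "A r c = s" "A r l = snd z"
          by (rule oa_row[OF o cij(1) sl(2,3,1) z(2)])
        then show "z \<in> (\<lambda>r. (A r c, A r l)) ` ?R s"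
          using z by (intro image_eqI[of _ _ r]) (auto simp: prod_eq_iff)
      next
        fix z assume "z \<in> (\<lambda>r. (A r c, A r l)) ` ?R s"
        then show "z \<in> {s} \<times> L" using bij_betwE[OF bl] by auto
      qed
    qed auto
  qed
  \<comment> \<open>Dropping the constant coordinate \<open>s\<close> is a bijection, so parities on
    \<open>L\<close> and on \<open>{s} \<times> L\<close> agree; the latter sets are disjoint for
    different \<open>s\<close> and can be united.\<close>
  have sn: "bij_betw snd ({s} \<times> L) L" for s
    by (rule bij_betw_byWitness[where f' = "Pair s"]) auto
  have b': "bij_betw (\<lambda>r. A r l) (?R s) L" if "s \<in> L" "l \<in> {1..k}" "c \<noteq> l" for s l
    using bij_betw_trans[OF b[OF that] sn] by (simp add: comp_def)
  have "perm_parity (row_perm n L A s c i j) =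
      bij_parity (?R s) ({s} \<times> L) (\<lambda>r. (A r c, A r i)) (\<lambda>r. (A r c, A r j))" if s: "s \<in> L" for s
  proof -
    have bi: "bij_betw (\<lambda>r. A r i) (?R s) L" and bj: "bij_betw (\<lambda>r. A r j) (?R s) L"
      using b' s cij by auto
    have "row_perm n L A s c i j = restrict_id ((\<lambda>r. A r j) \<circ> inv_into (?R s) (\<lambda>r. A r i)) L"
      unfolding row_perm_def
    proof (rule the_equality)
      show "restrict_id ((\<lambda>r. A r j) \<circ> inv_into (?R s) (\<lambda>r. A r i)) L permutes L \<and>
        (\<forall>r\<in>{1..n^2}. A r c = s \<longrightarrow>
          restrict_id ((\<lambda>r. A r j) \<circ> inv_into (?R s) (\<lambda>r. A r i)) L (A r i) = A r j)"
        using permutes_bij_quotient[OF bi bj] bij_quotient_apply[OF bi] by blast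
    next
      fix p
      assume "p permutes L \<and> (\<forall>r\<in>{1..n^2}. A r c = s \<longrightarrow> p (A r i) = A r j)"
      then show "p = restrict_id ((\<lambda>r. A r j) \<circ> inv_into (?R s) (\<lambda>r. A r i)) L"
        by (intro bij_quotient_unique[OF bi]) auto
    qed
    then have "perm_parity (row_perm n L A s c i j) = bij_parity (?R s) L (\<lambda>r. A r i) (\<lambda>r. A r j)"
      by (simp only: bij_parity_def)
    also have "\<dots> = bij_parity (?R s) L (snd \<circ> (\<lambda>r. (A r c, A r i))) (snd \<circ> (\<lambda>r. (A r c, A r j)))"
      by (simp add: comp_def)
    also have "\<dots> = bij_parity (?R s) ({s} \<times> L) (\<lambda>r. (A r c, A r i)) (\<lambda>r. (A r c, A r j))"
      by (rule bij_parity_comp) (use fin b s cij sn in auto)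
    finally show ?thesis .
  qed
  then have "tau_parity n L A c i j =
      (\<Sum>s\<in>L. bij_parity (?R s) ({s} \<times> L) (\<lambda>r. (A r c, A r i)) (\<lambda>r. (A r c, A r j)))"
    by (simp add: tau_parity_def)
  also have "\<dots> = bij_parity (\<Union>s\<in>L. ?R s) (\<Union>s\<in>L. {s} \<times> L) (\<lambda>r. (A r c, A r i)) (\<lambda>r. (A r c, A r j))"
    by (rule bij_parity_UN[symmetric]) (use fin b cij in auto)
  also have "(\<Union>s\<in>L. {s} \<times> L) = L \<times> L" by auto
  also have "(\<Union>s\<in>L. ?R s) = {1..n^2}"
    using oa_bij[OF o cij(1,2)] cij(4) by (auto dest!: bij_betwE)
  finally show ?thesis by (simp only: tau_def)
qed

text \<open>The first two conditions are symmetry and transitivity of the relative parity. The third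
  comes from the walk \<open>(c,i)\<close>, \<open>(i,c)\<close>, \<open>(i,j)\<close>,
  \<open>(j,i)\<close>, \<open>(j,c)\<close>, \<open>(c,j)\<close> through pairs of columns, where
  swaps alternate with changes of the second column.\<close>

lemma plausible_tau:
  assumes o: "oa k L R A" and n: "card L = n"
  shows "plausible k n (tau L R A)"
  unfolding plausible_def
proof (intro conjI ballI impI)
  let ?d = "bij_parity R (L \<times> L)" and ?E = "\<lambda>i j r. (A r i, A r j)"
  have fin: "finite (L \<times> L)" using oa_finite[OF o] by simp
  note b = oa_bij[OF o]
  fix c i j assume c: "c \<in> {1..k}" and i: "i \<in> {1..k}" and j: "j \<in> {1..k}"
  {
    assume d: "distinct [c, i, j]"
    show "tau L R A c i j = tau L R A c j i"
      unfolding tau_def by (rule bij_parity_sym) (use fin b c i j d in auto)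
    have sw: "?d (?E x y) (?E y x) = of_nat (n choose 2)"
      if "x \<in> {1..k}" "y \<in> {1..k}" "x \<noteq> y" for x y
    proof -
      \<comment> \<open>Identifying a row with its pair \<open>?E x y\<close> turns the exchange of
        columns into the swap on \<open>L \<times> L\<close>.\<close>
      have "?d (id \<circ> ?E x y) (prod.swap \<circ> ?E x y) = bij_parity (L \<times> L) (L \<times> L) id prod.swap"
        by (rule bij_parity_reindex)
          (use b that in \<open>auto intro!: bij_betw_byWitness[where f' = prod.swap]\<close>)
      then show ?thesis
        using bij_parity_swap[OF oa_finite[OF o]] n by (simp add: comp_def)
    qed
    have tr: "?d e f + ?d f g = ?d e g"
      if "bij_betw e R (L \<times> L)" "bij_betw f R (L \<times> L)" "bij_betw g R (L \<times> L)" for e f g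
      by (rule bij_parity_trans[OF fin that])
    have sy: "?d e f = ?d f e"
      if "bij_betw e R (L \<times> L)" "bij_betw f R (L \<times> L)" for e f
      by (rule bij_parity_sym[OF fin that])
    have bs: "bij_betw (?E c i) R (L \<times> L)" "bij_betw (?E i c) R (L \<times> L)"
      "bij_betw (?E c j) R (L \<times> L)" "bij_betw (?E j c) R (L \<times> L)"
      "bij_betw (?E i j) R (L \<times> L)" "bij_betw (?E j i) R (L \<times> L)"
      using b c i j d by auto
    have "tau L R A c i j = ?d (?E c i) (?E c j)" by (simp only: tau_def)
    also have "\<dots> = ?d (?E c i) (?E i c) + ?d (?E i c) (?E i j) + ?d (?E i j) (?E j i)
        + ?d (?E j i) (?E j c) + ?d (?E j c) (?E c j)"
      by (simp only: tr bs)
    also have "\<dots> = of_nat (n choose 2) + tau L R A i c j + of_nat (n choose 2)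
        + tau L R A j c i + of_nat (n choose 2)"
    proof -
      have "?d (?E c i) (?E i c) = of_nat (n choose 2)" "?d (?E i j) (?E j i) = of_nat (n choose 2)"
        "?d (?E j c) (?E c j) = of_nat (n choose 2)"
        using sw c i j d by auto
      moreover have "?d (?E j i) (?E j c) = tau L R A j c i"
        unfolding tau_def by (rule sy[OF bs(6,4)])
      ultimately show ?thesis by (simp only: tau_def)
    qed
    text \<open>Each of the three swaps contributes the parity \<open>n choose 2\<close>, and three copies of it amount to one.\<close>
    finally show "tau L R A c i j + tau L R A i c j + tau L R A j c i = of_nat (n choose 2)"
      by (simp only: ac_simps bit_add_self bit_add_left_self add_0_left add_0_right)
  }
  fix l assume l: "l \<in> {1..k}" and d: "distinct [c, i, j, l]"
  show "tau L R A c i j = tau L R A c i l + tau L R A c l j"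
    unfolding tau_def by (rule bij_parity_trans[symmetric]) (use fin b c i j l d in auto)
qed

section \<open>Renaming, exchange of subarrays and the affine space of plausible vectors\<close>

text \<open>The same \<open>h\<close> in all columns conjugates the permutations, and
  \<open>g\<close> only renames rows, so parities survive.\<close>

lemma oa_transport:
  assumes o: "oa k L R A" and h: "bij_betw h L L'" and g: "bij_betw g Q R"
  shows "oa k L' Q (\<lambda>r i. h (A (g r) i))"
    and "c \<in> {1..k} \<Longrightarrow> i \<in> {1..k} \<Longrightarrow> j \<in> {1..k} \<Longrightarrow> distinct [c, i, j] \<Longrightarrow>
      tau L' Q (\<lambda>r i. h (A (g r) i)) c i j = tau L R A c i j"
proof -
  have hh: "bij_betw (map_prod h h) (L \<times> L) (L' \<times> L')" using h h by (rule bij_betw_map_prod)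
  have b: "bij_betw ((\<lambda>r. (A r i, A r j)) \<circ> g) Q (L \<times> L)"
    if "i \<in> {1..k}" "j \<in> {1..k}" "i \<noteq> j" for i j
    by (rule bij_betw_trans[OF g oa_bij[OF o that]])
  have "bij_betw (\<lambda>r. (h (A (g r) i), h (A (g r) j))) Q (L' \<times> L')"
    if "i \<in> {1..k}" "j \<in> {1..k}" "i \<noteq> j" for i j
    using bij_betw_trans[OF b[OF that] hh] by (simp add: comp_def)
  then show "oa k L' Q (\<lambda>r i. h (A (g r) i))"
    using oa_finite[OF o] bij_betw_finite[OF h] by (simp add: oa_def)
  assume cij: "c \<in> {1..k}" "i \<in> {1..k}" "j \<in> {1..k}" "distinct [c, i, j]"
  have "tau L' Q (\<lambda>r i. h (A (g r) i)) c i j = bij_parity Q (L' \<times> L')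
      (map_prod h h \<circ> ((\<lambda>r. (A r c, A r i)) \<circ> g)) (map_prod h h \<circ> ((\<lambda>r. (A r c, A r j)) \<circ> g))"
    by (simp add: tau_def comp_def)
  also have "\<dots> = bij_parity Q (L \<times> L) ((\<lambda>r. (A r c, A r i)) \<circ> g) ((\<lambda>r. (A r c, A r j)) \<circ> g)"
    by (rule bij_parity_comp[OF _ b b hh]) (use oa_finite[OF o] cij in auto)
  also have "\<dots> = tau L R A c i j"
    unfolding tau_def by (rule bij_parity_reindex[OF oa_bij[OF o] oa_bij[OF o] g]) (use cij in auto)
  finally show "tau L' Q (\<lambda>r i. h (A (g r) i)) c i j = tau L R A c i j" .
qed

text \<open>The rows outside \<open>R0\<close> cover exactly the pairs outside
  \<open>S \<times> S\<close>, before and after the exchange. The parity splits accordingly, and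
  only the part on \<open>S \<times> S\<close> changes.\<close>

lemma oa_replace:
  assumes o: "oa k L R A" and sub: "S \<subseteq> L" "R0 \<subseteq> R" and o0: "oa k S R0 A" and oB: "oa k S R0 B"
  defines "A' \<equiv> \<lambda>r. if r \<in> R0 then B r else A r"
  shows "oa k L R A'"
    and "c \<in> {1..k} \<Longrightarrow> i \<in> {1..k} \<Longrightarrow> j \<in> {1..k} \<Longrightarrow> distinct [c, i, j] \<Longrightarrow>
      tau L R A' c i j = tau L R A c i j + (tau S R0 A c i j + tau S R0 B c i j)"
proof -
  let ?Y = "L \<times> L - S \<times> S"
  have R: "R0 \<union> (R - R0) = R" and X: "S \<times> S \<union> ?Y = L \<times> L" using sub by auto
  have fin: "finite (S \<times> S)" "finite ?Y"
    using oa_finite[OF o] oa_finite[OF o0] by auto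
  have bA: "bij_betw (\<lambda>r. (A r i, A r j)) (R - R0) ?Y"
    if "i \<in> {1..k}" "j \<in> {1..k}" "i \<noteq> j" for i j
    by (rule bij_betw_DiffI[OF oa_bij[OF o that] oa_bij[OF o0 that]]) (use sub in auto)
  have bA': "bij_betw (\<lambda>r. (A' r i, A' r j)) (R - R0) ?Y"
    if "i \<in> {1..k}" "j \<in> {1..k}" "i \<noteq> j" for i j
    using bA[OF that] by (subst bij_betw_cong[where g = "\<lambda>r. (A r i, A r j)"]) (auto simp: A'_def)
  have b0: "bij_betw (\<lambda>r. (A' r i, A' r j)) R0 (S \<times> S)"
    if "i \<in> {1..k}" "j \<in> {1..k}" "i \<noteq> j" for i j
    using oa_bij[OF oB that] by (subst bij_betw_cong[where g = "\<lambda>r. (B r i, B r j)"]) (auto simp: A'_def)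
  have "bij_betw (\<lambda>r. (A' r i, A' r j)) R (L \<times> L)"
    if "i \<in> {1..k}" "j \<in> {1..k}" "i \<noteq> j" for i j
    using bij_betw_combine[OF b0[OF that] bA'[OF that]] unfolding R X by blast
  then show "oa k L R A'" using oa_finite[OF o] by (simp add: oa_def)
  assume cij: "c \<in> {1..k}" "i \<in> {1..k}" "j \<in> {1..k}" "distinct [c, i, j]"
  have ci: "c \<noteq> i" "c \<noteq> j" using cij by auto
  let ?p = "bij_parity (R - R0) ?Y (\<lambda>r. (A r c, A r i)) (\<lambda>r. (A r c, A r j))"
  have dj: "S \<times> S \<inter> ?Y = {}" by blast
  have "tau L R A c i j = tau S R0 A c i j + ?p"
    using bij_parity_Un[OF fin dj oa_bij[OF o0 cij(1,2) ci(1)] oa_bij[OF o0 cij(1,3) ci(2)]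
        bA[OF cij(1,2) ci(1)] bA[OF cij(1,3) ci(2)]]
    unfolding R X tau_def .
  moreover have "tau L R A' c i j =
      bij_parity R0 (S \<times> S) (\<lambda>r. (A' r c, A' r i)) (\<lambda>r. (A' r c, A' r j)) +
      bij_parity (R - R0) ?Y (\<lambda>r. (A' r c, A' r i)) (\<lambda>r. (A' r c, A' r j))"
    using bij_parity_Un[OF fin dj b0[OF cij(1,2) ci(1)] b0[OF cij(1,3) ci(2)]
        bA'[OF cij(1,2) ci(1)] bA'[OF cij(1,3) ci(2)]]
    unfolding R X tau_def .
  moreover have "bij_parity R0 (S \<times> S) (\<lambda>r. (A' r c, A' r i)) (\<lambda>r. (A' r c, A' r j)) = tau S R0 B c i j"
    unfolding tau_def
    by (rule bij_parity_cong[OF oa_bij[OF oB cij(1,2) ci(1)] oa_bij[OF oB cij(1,3) ci(2)]])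
       (auto simp: A'_def)
  moreover have "bij_parity (R - R0) ?Y (\<lambda>r. (A' r c, A' r i)) (\<lambda>r. (A' r c, A' r j)) = ?p"
    by (rule bij_parity_cong[OF bA[OF cij(1,2) ci(1)] bA[OF cij(1,3) ci(2)]]) (auto simp: A'_def)
  ultimately show "tau L R A' c i j = tau L R A c i j + (tau S R0 A c i j + tau S R0 B c i j)"
    by (simp only: ac_simps bit_add_left_self)
qed

lemma
  assumes "plausible k n t" "c \<in> {1..k}" "i \<in> {1..k}" "j \<in> {1..k}"
  shows plausible_sym: "distinct [c, i, j] \<Longrightarrow> t c i j = t c j i"
    and plausible_split: "l \<in> {1..k} \<Longrightarrow> distinct [c, i, j, l] \<Longrightarrow> t c i j = t c i l + t c l j"
    and plausible_cyclic: "distinct [c, i, j] \<Longrightarrow> t c i j + t i c j + t j c i = of_nat (n choose 2)"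
  using assms unfolding plausible_def by blast+

text \<open>In \<open>\<int>\<close>-mod-2 arithmetic \<open>s + t\<close> is a difference of
  plausible vectors, so it satisfies the homogeneous relations, in which the order no longer
  occurs.\<close>

lemma plausible_add3:
  assumes s: "plausible k N s" and t: "plausible k N t" and u: "plausible k n u"
  shows "plausible k n (\<lambda>c i j. s c i j + (t c i j + u c i j))"
  unfolding plausible_def
proof (intro conjI ballI impI)
  fix c i j assume c: "c \<in> {1..k}" and i: "i \<in> {1..k}" and j: "j \<in> {1..k}"
  {
    assume d: "distinct [c, i, j]"
    have "s c i j = s c j i" "t c i j = t c j i" "u c i j = u c j i"
      by (rule plausible_sym[OF s c i j d] plausible_sym[OF t c i j d] plausible_sym[OF u c i j d])+
    then show "s c i j + (t c i j + u c i j) = s c j i + (t c j i + u c j i)" by simp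
    have "s c i j + s i c j + s j c i = of_nat (N choose 2)"
      "t c i j + t i c j + t j c i = of_nat (N choose 2)"
      "u c i j + u i c j + u j c i = of_nat (n choose 2)"
      by (rule plausible_cyclic[OF s c i j d] plausible_cyclic[OF t c i j d]
          plausible_cyclic[OF u c i j d])+
    then have "(s c i j + s i c j + s j c i) + ((t c i j + t i c j + t j c i) + (u c i j + u i c j + u j c i))
        = of_nat (n choose 2)"
      by (simp only: bit_add_left_self)
    then show "s c i j + (t c i j + u c i j) + (s i c j + (t i c j + u i c j)) +
        (s j c i + (t j c i + u j c i)) = of_nat (n choose 2)"
      by (simp only: ac_simps)
  }
  fix l assume l: "l \<in> {1..k}" and d: "distinct [c, i, j, l]"
  have "s c i j = s c i l + s c l j" "t c i j = t c i l + t c l j" "u c i j = u c i l + u c l j"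
    by (rule plausible_split[OF s c i j l d] plausible_split[OF t c i j l d]
        plausible_split[OF u c i j l d])+
  then show "s c i j + (t c i j + u c i j) =
      s c i l + (t c i l + u c i l) + (s c l j + (t c l j + u c l j))"
    by (simp only: ac_simps)
qed

text \<open>The empty subarray makes \<open>n = 0\<close> the plain existence of an \<open>OA(k,N)\<close>.\<close>
definition has_sub_oa :: "nat \<Rightarrow> nat \<Rightarrow> nat \<Rightarrow> bool" where
  "has_sub_oa k N n \<longleftrightarrow> (\<exists>(L :: nat set) (R :: nat set) A S R0.
     oa k L R A \<and> card L = N \<and> S \<subseteq> L \<and> R0 \<subseteq> R \<and> oa k S R0 A \<and> card S = n)"

lemma actual_of_sub_oa:
  assumes k: "2 \<le> k" and sub: "has_sub_oa k N n"
    and n: "\<And>t. plausible k n t \<Longrightarrow> actual k n t" and t: "plausible k N t"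
  shows "actual k N t"
proof -
  obtain L R A S R0 where o: "oa k (L :: nat set) (R :: nat set) A" and N: "card L = N"
    and s: "S \<subseteq> L" "R0 \<subseteq> R" and o0: "oa k S R0 A" and cS: "card S = n"
    using sub unfolding has_sub_oa_def by blast
  \<comment> \<open>The parity that the new subarray must have for the exchange to turn the parity
    of \<open>A\<close> into \<open>t\<close>.\<close>
  let ?u = "\<lambda>c i j. t c i j + (tau L R A c i j + tau S R0 A c i j)"
  have "plausible k n ?u"
    by (rule plausible_add3[OF t plausible_tau[OF o N] plausible_tau[OF o0 cS]])
  then obtain M :: "nat set" and B where "orthogonal_array k n M B" and
    tB: "\<And>c i j. c \<in> {1..k} \<Longrightarrow> i \<in> {1..k} \<Longrightarrow> j \<in> {1..k} \<Longrightarrow> distinct [c, i, j] \<Longrightarrow>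
      tau_parity n M B c i j = ?u c i j"
    using n[of ?u] unfolding actual_def by blast
  then have cM: "card M = n" and oB: "oa k M {1..n^2} B"
    by (simp_all add: orthogonal_array_iff_oa[OF k])
  \<comment> \<open>Equal numbers of rows and of symbols allow \<open>B\<close> to be carried onto
    the place of the subarray, and the rows of the result to be numbered from \<open>1\<close> to
    \<open>N^2\<close>.\<close>
  have "finite R0" "card R0 = card {1..n^2}" "finite R" "card {1..N^2} = card R"
    using oa_card_rows[OF o k] oa_card_rows[OF o0 k] N cS by auto
  then obtain g f where g: "bij_betw g R0 {1..n^2}" and f: "bij_betw f {1..N^2} R"
    by (meson finite_atLeastAtMost finite_same_card_bij)
  obtain h where h: "bij_betw h M S"
    using finite_same_card_bij[of M S] oa_finite[OF oB] oa_finite[OF o0] cM cS by auto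
  define C where "C = (\<lambda>r i. h (B (g r) i))"
  have oC: "oa k S R0 C" unfolding C_def by (rule oa_transport(1)[OF oB h g])
  define D where "D = (\<lambda>r. if r \<in> R0 then C r else A r)"
  have oD: "oa k L R D" unfolding D_def by (rule oa_replace(1)[OF o s o0 oC])
  have idL: "bij_betw id L L" by simp
  define F where "F = (\<lambda>r i. id (D (f r) i))"
  have oF: "oa k L {1..N^2} F" unfolding F_def by (rule oa_transport(1)[OF oD idL f])
  have "tau_parity N L F c i j = t c i j"
    if cij: "c \<in> {1..k}" "i \<in> {1..k}" "j \<in> {1..k}" "distinct [c, i, j]" for c i j
  proof -
    have "tau_parity N L F c i j = tau L R D c i j"
      using tau_parity_eq_tau[OF oF cij] oa_transport(2)[OF oD idL f cij] by (simp only: F_def)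
    also have "\<dots> = tau L R A c i j + (tau S R0 A c i j + tau S R0 C c i j)"
      unfolding D_def by (rule oa_replace(2)[OF o s o0 oC cij])
    also have "tau S R0 C c i j = tau_parity n M B c i j"
      using tau_parity_eq_tau[OF oB cij] oa_transport(2)[OF oB h g cij] by (simp only: C_def)
    also have "\<dots> = ?u c i j" by (rule tB[OF cij])
    finally show ?thesis
      by (simp only: ac_simps bit_add_self bit_add_left_self add_0_left add_0_right)
  qed
  then show ?thesis
    unfolding actual_def using oF N orthogonal_array_iff_oa[OF k, of N L F] by blast
qed

section \<open>Constructions of orthogonal arrays\<close>

lemma oa_cong:
  assumes "oa k L R A" "\<And>r i. r \<in> R \<Longrightarrow> i \<in> {1..k} \<Longrightarrow> B r i = A r i"
  shows "oa k L R B"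
  unfolding oa_def
proof (intro conjI ballI impI)
  fix i j assume ij: "i \<in> {1..k}" "j \<in> {1..k}" "i \<noteq> j"
  show "bij_betw (\<lambda>r. (B r i, B r j)) R (L \<times> L)"
    using oa_bij[OF assms(1) ij] assms(2) ij
    by (subst bij_betw_cong[where g = "\<lambda>r. (A r i, A r j)"]) auto
qed (rule oa_finite[OF assms(1)])

text \<open>There are as many rows as pairs of symbols, so injectivity suffices here and
  surjectivity in the next lemma.\<close>

lemma oaI_inj:
  assumes "finite L" "card R = card L ^ 2" "2 \<le> k"
    and "\<And>r i. r \<in> R \<Longrightarrow> i \<in> {1..k} \<Longrightarrow> A r i \<in> L"
    and "\<And>i j r s. i \<in> {1..k} \<Longrightarrow> j \<in> {1..k} \<Longrightarrow> i \<noteq> j \<Longrightarrow> r \<in> R \<Longrightarrow> s \<in> R \<Longrightarrow>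
      A r i = A s i \<Longrightarrow> A r j = A s j \<Longrightarrow> r = s"
  shows "oa k L R A"
  unfolding oa_def
proof (intro conjI ballI impI)
  fix i j assume ij: "i \<in> {1..k}" "j \<in> {1..k}" "i \<noteq> j"
  let ?f = "\<lambda>r. (A r i, A r j)"
  have inj: "inj_on ?f R" using assms(5)[OF ij] by (auto intro: inj_onI)
  moreover have "?f ` R = L \<times> L"
  proof (rule card_subset_eq)
    show "card (?f ` R) = card (L \<times> L)"
      using card_image[OF inj] assms(2) by (simp add: card_cartesian_product power2_eq_square)
  qed (use assms ij in auto)
  ultimately show "bij_betw ?f R (L \<times> L)" by (simp add: bij_betw_def)
qed (rule assms)

lemma oaI_surj:
  assumes "finite L" "finite R" "card R = card L ^ 2" "2 \<le> k"
    and "\<And>r i. r \<in> R \<Longrightarrow> i \<in> {1..k} \<Longrightarrow> A r i \<in> L"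
    and "\<And>i j x y. i \<in> {1..k} \<Longrightarrow> j \<in> {1..k} \<Longrightarrow> i \<noteq> j \<Longrightarrow> x \<in> L \<Longrightarrow> y \<in> L \<Longrightarrow>
      \<exists>r\<in>R. A r i = x \<and> A r j = y"
  shows "oa k L R A"
  unfolding oa_def
proof (intro conjI ballI impI)
  fix i j assume ij: "i \<in> {1..k}" "j \<in> {1..k}" "i \<noteq> j"
  let ?f = "\<lambda>r. (A r i, A r j)"
  have im: "?f ` R = L \<times> L"
  proof (intro equalityI subsetI)
    fix z assume "z \<in> L \<times> L"
    then have "\<exists>r\<in>R. A r i = fst z \<and> A r j = snd z" by (intro assms(6)[OF ij]) auto
    then obtain r where "r \<in> R" "A r i = fst z" "A r j = snd z" by blast
    then show "z \<in> ?f ` R" by (intro image_eqI[of _ _ r]) auto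
  qed (use assms(5) ij in auto)
  moreover have "inj_on ?f R"
    using assms(2,3) im by (intro eq_card_imp_inj_on) (simp_all add: card_cartesian_product power2_eq_square)
  ultimately show "bij_betw ?f R (L \<times> L)" by (simp add: bij_betw_def)
qed (rule assms)

section \<open>Arrays over natural numbers and constant rows\<close>

text \<open>Lets the constructions use products and sums as symbols and rows; injections into the
  natural numbers encode both afterwards.\<close>

lemma has_sub_oaI:
  assumes k: "2 \<le> k" and o: "oa k L R A" and N: "card L = N"
    and s: "S \<subseteq> L" "R0 \<subseteq> R" and o0: "oa k S R0 A" and n: "card S = n"
  shows "has_sub_oa k N n"
proof -
  obtain h :: "_ \<Rightarrow> nat" where h: "inj_on h L"
    using finite_imp_inj_to_nat_seg[OF oa_finite[OF o]] by blast
  obtain g :: "_ \<Rightarrow> nat" where g: "inj_on g R"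
    using finite_imp_inj_to_nat_seg[OF oa_card_rows(2)[OF o k]] by blast
  let ?A = "\<lambda>r i. h (A (inv_into R g r) i)"
  have "oa k (h ` L) (g ` R) ?A"
    by (rule oa_transport(1)[OF o]) (use h g in \<open>auto intro: inj_on_imp_bij_betw bij_betw_inv_into\<close>)
  moreover have "oa k (h ` S) (g ` R0) ?A"
  proof (rule oa_transport(1)[OF o0])
    show "bij_betw h S (h ` S)" by (rule inj_on_imp_bij_betw[OF inj_on_subset[OF h s(1)]])
    show "bij_betw (inv_into R g) (g ` R0) R0"
      by (rule bij_betw_subset[OF bij_betw_inv_into[OF inj_on_imp_bij_betw[OF g]]])
         (use s(2) inv_into_image_cancel[OF g s(2)] in auto)
  qed
  moreover have "card (h ` L) = N" "card (h ` S) = n"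
    using N n h s(1) by (auto simp: card_image inj_on_subset)
  ultimately show ?thesis
    unfolding has_sub_oa_def using image_mono[OF s(1), of h] image_mono[OF s(2), of g]
    by (intro exI conjI)
qed

abbreviation has_oa :: "nat \<Rightarrow> nat \<Rightarrow> bool" where
  "has_oa k N \<equiv> has_sub_oa k N 0"

lemma has_oaI:
  assumes "2 \<le> k" "oa k L R A" "card L = N"
  shows "has_oa k N"
  by (rule has_sub_oaI[OF assms, of "{}" "{}"]) (auto simp: oa_def bij_betw_def)

lemma has_oaE:
  assumes "has_oa k N" "2 \<le> k" "finite L" "card L = N"
  obtains R :: "nat set" and A where "oa k L R A"
proof -
  obtain M :: "nat set" and R :: "nat set" and A where o: "oa k M R A" "card M = N"
    using assms(1) unfolding has_sub_oa_def by blast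
  obtain h where h: "bij_betw h M L"
    using finite_same_card_bij[OF oa_finite[OF o(1)] assms(3)] o(2) assms(4) by auto
  show thesis
    by (rule that[OF oa_transport(1)[OF o(1) h, of id R]]) simp
qed

text \<open>Permuting the symbols of each column separately keeps orthogonality. It may change the
  parities, but this is used only where existence matters.\<close>

lemma oa_constant_row:
  assumes o: "oa k L R A" and w: "w \<in> L" and k: "2 \<le> k"
  obtains A' r0 where "oa k L R A'" "r0 \<in> R" "\<And>i. i \<in> {1..k} \<Longrightarrow> A' r0 i = w"
proof -
  obtain r0 where r0: "r0 \<in> R"
    by (rule oa_row[OF o _ _ _ w w, of 1 2]) (use k in auto)
  have p: "transpose w (A r0 i) permutes L" if "i \<in> {1..k}" for i
    using that w oa_entry[OF o k _ r0] by (intro permutes_swap_id) auto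
  let ?A = "\<lambda>r i. transpose w (A r0 i) (A r i)"
  have "oa k L R ?A"
    unfolding oa_def
  proof (intro conjI ballI impI)
    fix i j assume ij: "i \<in> {1..k}" "j \<in> {1..k}" "i \<noteq> j"
    show "bij_betw (\<lambda>r. (?A r i, ?A r j)) R (L \<times> L)"
      using bij_betw_trans[OF oa_bij[OF o ij] bij_betw_map_prod[OF
            permutes_imp_bij[OF p[OF ij(1)]] permutes_imp_bij[OF p[OF ij(2)]]]]
      by (simp add: comp_def)
  qed (rule oa_finite[OF o])
  then show thesis by (rule that[OF _ r0]) simp
qed

section \<open>Products, linear forms and Wilson's construction\<close>

text \<open>In the direct product, the constant row \<open>q\<close> of \<open>B\<close> carries a
  copy of \<open>A\<close>.\<close>

lemma has_sub_oa_product: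
  assumes k: "2 \<le> k" and "has_oa k m" "has_oa k n" "0 < m"
  shows "has_sub_oa k (n * m) n"
proof -
  obtain R :: "nat set" and A where o: "oa k {..<n} R A"
    by (rule has_oaE[OF assms(3) k, of "{..<n}"]) auto
  obtain Q :: "nat set" and B' where B': "oa k {..<m} Q B'"
    by (rule has_oaE[OF assms(2) k, of "{..<m}"]) auto
  obtain B q where B: "oa k {..<m} Q B" "q \<in> Q" "\<And>i. i \<in> {1..k} \<Longrightarrow> B q i = 0"
    using oa_constant_row[OF B' _ k, of 0] assms(4) by auto
  let ?C = "\<lambda>r i. (A (fst r) i, B (snd r) i)"
  show ?thesis
  proof (rule has_sub_oaI[OF k])
    show "oa k ({..<n} \<times> {..<m}) (R \<times> Q) ?C"
    proof (rule oaI_surj)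
      show "card (R \<times> Q) = card ({..<n} \<times> {..<m}) ^ 2"
        using oa_card_rows[OF o k] oa_card_rows[OF B(1) k]
        by (simp add: card_cartesian_product power_mult_distrib)
      show "\<exists>r\<in>R \<times> Q. ?C r i = x \<and> ?C r j = y"
        if ij: "i \<in> {1..k}" "j \<in> {1..k}" "i \<noteq> j" and xy: "x \<in> {..<n} \<times> {..<m}" "y \<in> {..<n} \<times> {..<m}"
        for i j x y
      proof -
        have x: "fst x \<in> {..<n}" "snd x \<in> {..<m}" and y: "fst y \<in> {..<n}" "snd y \<in> {..<m}"
          using xy by auto
        obtain r where "r \<in> R" "A r i = fst x" "A r j = fst y"
          by (rule oa_row[OF o ij x(1) y(1)])
        moreover obtain s where "s \<in> Q" "B s i = snd x" "B s j = snd y"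
          by (rule oa_row[OF B(1) ij x(2) y(2)])
        ultimately show ?thesis by (intro bexI[of _ "(r, s)"]) (auto simp: prod_eq_iff)
      qed
    qed (use oa_entry[OF o k] oa_entry[OF B(1) k] oa_card_rows(2)[OF o k] oa_card_rows(2)[OF B(1) k] k in auto)
    show "oa k ({..<n} \<times> {0}) (R \<times> {q}) ?C"
    proof (rule oa_cong)
      show "oa k ({..<n} \<times> {0 :: nat}) (R \<times> {q}) (\<lambda>r i. (A (fst r) i, 0))"
        by (rule oa_transport(1)[OF o, where h = "\<lambda>x. (x, 0)" and g = fst])
           (auto intro!: bij_betw_byWitness[where f' = fst] bij_betw_byWitness[where f' = "\<lambda>x. (x, q)"])
    qed (auto simp: B(3))
  qed (use B(2) assms(4) in \<open>auto simp: card_cartesian_product\<close>)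
qed

text \<open>Column \<open>i\<close> is the form \<open>x + g i * y\<close> on pairs of residues
  modulo \<open>f\<close>. Two columns determine \<open>y\<close>, since \<open>g i - g j\<close>
  cancels modulo \<open>f\<close>, and then \<open>x\<close>. It is applied to polynomials and to
  integers.\<close>

lemma has_oa_linear:
  fixes f :: "'a :: unique_euclidean_ring" and g :: "nat \<Rightarrow> 'a"
  assumes k: "2 \<le> k" and fin: "finite (range (\<lambda>x. x mod f))"
    and g: "\<And>i j y. i \<in> {1..k} \<Longrightarrow> j \<in> {1..k} \<Longrightarrow> i \<noteq> j \<Longrightarrow> f dvd (g i - g j) * y \<Longrightarrow> f dvd y"
  shows "has_oa k (card (range (\<lambda>x. x mod f)))"
proof -
  let ?L = "range (\<lambda>x. x mod f)"
  have "oa k ?L (?L \<times> ?L) (\<lambda>r i. (fst r + g i * snd r) mod f)"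
  proof (rule oaI_inj[OF fin _ k])
    fix i j r s assume ij: "i \<in> {1..k}" "j \<in> {1..k}" "i \<noteq> j"
      and r: "r \<in> ?L \<times> ?L" and s: "s \<in> ?L \<times> ?L"
      and "(fst r + g i * snd r) mod f = (fst s + g i * snd s) mod f"
        "(fst r + g j * snd r) mod f = (fst s + g j * snd s) mod f"
    then have i: "f dvd (fst r + g i * snd r) - (fst s + g i * snd s)"
      and j: "f dvd (fst r + g j * snd r) - (fst s + g j * snd s)"
      by (simp_all add: mod_eq_dvd_iff)
    have "f dvd (g i - g j) * (snd r - snd s)"
      using dvd_diff[OF i j] by (simp add: algebra_simps)
    then have d: "f dvd snd r - snd s" using g ij by blast
    then have "snd r mod f = snd s mod f" by (simp add: mod_eq_dvd_iff)
    moreover have "f dvd fst r - fst s"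
      using dvd_diff[OF i dvd_mult[OF d, of "g i"]] by (simp add: algebra_simps)
    then have "fst r mod f = fst s mod f" by (simp add: mod_eq_dvd_iff)
    ultimately show "r = s" using r s by (auto simp: prod_eq_iff)
  qed (auto simp: card_cartesian_product power2_eq_square)
  then show ?thesis by (rule has_oaI[OF k]) simp
qed

text \<open>The symbols are \<open>t\<close> groups of \<open>m\<close> points and \<open>u\<close>
  extra points. A row of \<open>T\<close> picks a group for each column; it is inflated by
  \<open>A\<close> if its last entry is at least \<open>u\<close>, and otherwise by \<open>B\<close>
  with that entry as extra point. \<open>U\<close> supplies the pairs of extra points.\<close>

lemma has_oa_Wilson:
  assumes k: "2 \<le> k" and m: "has_sub_oa k m n" and m1: "has_oa k (m + 1)"
    and t: "has_oa (k + 1) t" and u: "has_oa k u" and ut: "u < t"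
  shows "has_sub_oa k (m * t + u) n"
proof -
  let ?e = "k + 1"
  have k': "2 \<le> ?e" using k by simp
  obtain M :: "nat set" and Q :: "nat set" and A S Q0 where A: "oa k M Q A" "card M = m"
    and S: "S \<subseteq> M" "Q0 \<subseteq> Q" "oa k S Q0 A" "card S = n"
    using m unfolding has_sub_oa_def by blast
  have finM: "finite M" by (rule oa_finite[OF A(1)])
  let ?M1 = "insert None (Some ` M)"
  have cM1: "card ?M1 = m + 1" using finM A(2) by (simp add: card_image)
  obtain P :: "nat set" and B' where B': "oa k ?M1 P B'"
    by (rule has_oaE[OF m1 k, of ?M1]) (use finM cM1 in auto)
  obtain B b where B: "oa k ?M1 P B" and b: "b \<in> P" "\<And>i. i \<in> {1..k} \<Longrightarrow> B b i = None"
    using oa_constant_row[OF B' _ k, of None] by auto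
  obtain R :: "nat set" and T' where T': "oa ?e {..<t} R T'"
    by (rule has_oaE[OF t k', of "{..<t}"]) auto
  \<comment> \<open>As \<open>u < t\<close>, the symbol \<open>u\<close> is available, and it is not
    below \<open>u\<close>. So \<open>r0\<close> is inflated by \<open>A\<close> and carries a copy
    of \<open>A\<close> with its subarray on the group \<open>u\<close>.\<close>
  obtain T r0 where T: "oa ?e {..<t} R T" and r0: "r0 \<in> R" "\<And>i. i \<in> {1..?e} \<Longrightarrow> T r0 i = u"
    using oa_constant_row[OF T' _ k', of u] ut by auto
  obtain V :: "nat set" and U where U: "oa k {..<u} V U"
    by (rule has_oaE[OF u k, of "{..<u}"]) auto
  text \<open>
    The symbol \<open>None\<close>, added to the \<open>m\<close> symbols \<open>Some x\<close>, is the point that blocks of \<open>T\<close> share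
    when their last entry is the same \<open>h < u\<close>; the row of \<open>B\<close> with only \<open>None\<close> is left to \<open>U\<close>.
  \<close>
  define lift where "lift = (\<lambda>g h z. (case z of None \<Rightarrow> Inr h | Some x \<Rightarrow> Inl (g, x)) :: (nat \<times> nat) + nat)"
  define R0 where "R0 = {r \<in> R. T r ?e \<notin> {..<u}}"
  define R1 where "R1 = {r \<in> R. T r ?e \<in> {..<u}}"
  let ?L = "({..<t} \<times> M) <+> {..<u}"
  let ?R = "(R0 \<times> Q) <+> ((R1 \<times> (P - {b})) <+> V)"
  define C where "C = (\<lambda>z i. (case z of
      Inl (r, a) \<Rightarrow> Inl (T r i, A a i)
    | Inr (Inl (r, p)) \<Rightarrow> lift (T r i) (T r ?e) (B p i)
    | Inr (Inr v) \<Rightarrow> Inr (U v i)))"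
  have C: "C (Inl (r, a)) i = Inl (T r i, A a i)"
    "C (Inr (Inl (r, p))) i = lift (T r i) (T r ?e) (B p i)"
    "C (Inr (Inr v)) i = Inr (U v i)" for r a p v i
    by (simp_all add: C_def)
  have lift: "lift g h None = Inr h" "lift g h (Some x) = Inl (g, x)" for g h x
    by (simp_all add: lift_def)
  have fins: "finite R" "finite Q" "finite P" "finite V"
    by (rule oa_card_rows(2)[OF T k'] oa_card_rows(2)[OF A(1) k] oa_card_rows(2)[OF B k]
        oa_card_rows(2)[OF U k])+
  have col: "i \<in> {1..?e}" "?e \<in> {1..?e}" "i \<noteq> ?e" if "i \<in> {1..k}" for i using that by auto
  have cR1: "card R1 = t * u"
  proof -
    have c1: "1 \<in> {1..?e}" "?e \<in> {1..?e}" "1 \<noteq> ?e" using k by auto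
    have "(\<lambda>r. (T r 1, T r ?e)) ` R1 = {..<t} \<times> {..<u}"
    proof (intro equalityI subsetI)
      fix z assume "z \<in> {..<t} \<times> {..<u}"
      then have z: "fst z \<in> {..<t}" "snd z \<in> {..<t}" "snd z \<in> {..<u}" using ut by auto
      obtain r where "r \<in> R" "T r 1 = fst z" "T r ?e = snd z"
        by (rule oa_row[OF T c1 z(1,2)])
      then show "z \<in> (\<lambda>r. (T r 1, T r ?e)) ` R1"
        using z by (intro image_eqI[of _ _ r]) (simp_all add: R1_def)
    next
      fix z assume "z \<in> (\<lambda>r. (T r 1, T r ?e)) ` R1"
      then show "z \<in> {..<t} \<times> {..<u}" using oa_entry[OF T k' c1(1)] by (auto simp: R1_def)
    qed
    then have "bij_betw (\<lambda>r. (T r 1, T r ?e)) R1 ({..<t} \<times> {..<u})"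
      by (intro bij_betw_subset[OF oa_bij[OF T c1]]) (auto simp: R1_def)
    from bij_betw_same_card[OF this] show ?thesis by (simp add: card_cartesian_product)
  qed
  have cR: "card R0 + card R1 = t ^ 2"
  proof -
    have "R0 \<union> R1 = R" "R0 \<inter> R1 = {}" by (auto simp: R0_def R1_def)
    then show ?thesis
      using card_Un_disjoint[of R0 R1] fins(1) oa_card_rows(1)[OF T k'] by (metis card_lessThan finite_Un)
  qed
  \<comment> \<open>This is \<open>(m + 1)^2 - 1\<close>, the constant row being left out.\<close>
  have cP: "card (P - {b}) = m * (m + 2)"
    using oa_card_rows(1)[OF B k] cM1 b(1) fins(3) by (simp add: power2_eq_square algebra_simps)
  have cRR: "card ?R = (m * t + u) ^ 2"
  proof -
    have "card ?R = card R0 * m ^ 2 + (card R1 * (m * (m + 2)) + u ^ 2)"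
      using fins cP oa_card_rows(1)[OF A(1) k] oa_card_rows(1)[OF U k] A(2)
      by (simp add: card_Plus card_cartesian_product R0_def R1_def)
    also have "\<dots> = (card R0 + card R1) * m ^ 2 + 2 * m * card R1 + u ^ 2"
      by (simp add: algebra_simps power2_eq_square)
    also have "\<dots> = (m * t + u) ^ 2" unfolding cR unfolding cR1 by (simp add: algebra_simps power2_eq_square)
    finally show ?thesis .
  qed
  have "oa k ?L ?R C"
  proof (rule oaI_surj)
    show "finite ?L" using finM by simp
    show "finite ?R" using fins by (simp add: R0_def R1_def)
    show "card ?R = card ?L ^ 2" using cRR finM A(2) by (simp add: card_Plus card_cartesian_product mult.commute)
    show "C z i \<in> ?L" if z: "z \<in> ?R" and i: "i \<in> {1..k}" for z i
    proof -
      consider r a where "z = Inl (r, a)" "r \<in> R" "a \<in> Q"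
        | r p where "z = Inr (Inl (r, p))" "r \<in> R1" "p \<in> P"
        | v where "z = Inr (Inr v)" "v \<in> V"
        using z by (auto simp: R0_def)
      then show ?thesis
      proof cases
        case 1
        then show ?thesis using oa_entry[OF T k' col(1)[OF i]] oa_entry[OF A(1) k i] by (auto simp: C)
      next
        case 2
        then have "T r i \<in> {..<t}" "T r ?e \<in> {..<u}" "B p i \<in> ?M1"
          using oa_entry[OF T k' col(1)[OF i]] oa_entry[OF B k i] by (auto simp: R1_def)
        then show ?thesis using 2 by (auto simp: C lift)
      next
        case 3
        then show ?thesis using oa_entry[OF U k i] by (auto simp: C)
      qed
    qed
    fix i j x y assume ij: "i \<in> {1..k}" "j \<in> {1..k}" "i \<noteq> j" and xy: "x \<in> ?L" "y \<in> ?L"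
    \<comment> \<open>The group \<open>g\<close> in column \<open>i\<close> and the extra point
      \<open>h\<close> in the last column determine the row of \<open>T\<close>;
      \<open>Some a\<close> and \<open>None\<close> then determine the row of
      \<open>B\<close>.\<close>
    have mixed: "\<exists>z\<in>?R. C z i = Inl (g, a) \<and> C z j = Inr h"
      if gah: "g < t" "a \<in> M" "h < u" and ij: "i \<in> {1..k}" "j \<in> {1..k}" "i \<noteq> j" for g a h i j
    proof -
      have hg: "g \<in> {..<t}" "h \<in> {..<t}" using gah ut by auto
      obtain r where r: "r \<in> R" "T r i = g" "T r ?e = h"
        by (rule oa_row[OF T col[OF ij(1)] hg])
      have ab: "Some a \<in> ?M1" "None \<in> ?M1" using gah by auto
      obtain p where p: "p \<in> P" "B p i = Some a" "B p j = None"
        by (rule oa_row[OF B ij ab])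
      have "p \<noteq> b" using p b(2)[OF ij(1)] by auto
      then show ?thesis
        by (intro bexI[of _ "Inr (Inl (r, p))"]) (use p r gah in \<open>auto simp: C lift R1_def\<close>)
    qed
    consider (LL) g a h c where "x = Inl (g, a)" "y = Inl (h, c)" "g < t" "h < t" "a \<in> M" "c \<in> M"
      | (LR) g a h where "x = Inl (g, a)" "y = Inr h" "g < t" "a \<in> M" "h < u"
      | (RL) g a h where "y = Inl (g, a)" "x = Inr h" "g < t" "a \<in> M" "h < u"
      | (RR) g h where "x = Inr g" "y = Inr h" "g < u" "h < u"
      using xy by auto
    then show "\<exists>z\<in>?R. C z i = x \<and> C z j = y"
    proof cases
      case LL
      \<comment> \<open>The two groups, equal or not, determine the row of \<open>T\<close>; its
        last entry decides whether \<open>B\<close> or \<open>A\<close> provides the points in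
        them.\<close>
      have gh: "g \<in> {..<t}" "h \<in> {..<t}" using LL by auto
      obtain r where r: "r \<in> R" "T r i = g" "T r j = h"
        by (rule oa_row[OF T col(1)[OF ij(1)] col(1)[OF ij(2)] ij(3) gh])
      show ?thesis
      proof (cases "T r ?e \<in> {..<u}")
        case True
        have ac: "Some a \<in> ?M1" "Some c \<in> ?M1" using LL by auto
        obtain p where p: "p \<in> P" "B p i = Some a" "B p j = Some c"
          by (rule oa_row[OF B ij ac])
        have "p \<noteq> b" using p b(2)[OF ij(1)] by auto
        then show ?thesis
          by (intro bexI[of _ "Inr (Inl (r, p))"]) (use p r True LL in \<open>auto simp: C lift R1_def\<close>)
      next
        case False
        obtain q where "q \<in> Q" "A q i = a" "A q j = c"
          by (rule oa_row[OF A(1) ij LL(5,6)])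
        then show ?thesis
          by (intro bexI[of _ "Inl (r, q)"]) (use r False LL in \<open>auto simp: C R0_def\<close>)
      qed
    next
      case LR
      then show ?thesis using mixed[of g a h i j] ij by auto
    next
      case RL
      then show ?thesis using mixed[of g a h j i] ij by auto
    next
      case RR
      have gh: "g \<in> {..<u}" "h \<in> {..<u}" using RR by auto
      obtain v where "v \<in> V" "U v i = g" "U v j = h"
        by (rule oa_row[OF U ij gh])
      then show ?thesis by (intro bexI[of _ "Inr (Inr v)"]) (use RR in \<open>auto simp: C\<close>)
    qed
  qed (rule k)
  moreover have "oa k (Inl ` ({u} \<times> S)) (Inl ` ({r0} \<times> Q0)) C"
  proof (rule oa_cong)
    show "oa k (Inl ` ({u} \<times> S) :: ((nat \<times> nat) + nat) set) (Inl ` ({r0} \<times> Q0))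
        (\<lambda>z i. Inl (u, A (snd (projl z)) i))"
      by (rule oa_transport(1)[OF S(3), where h = "\<lambda>x. Inl (u, x)"])
         (auto intro!: bij_betw_byWitness[where f' = "\<lambda>x. snd (projl x)"]
            bij_betw_byWitness[where f' = "\<lambda>x. Inl (r0, x)"])
  qed (use r0(2) in \<open>auto simp: C\<close>)
  moreover have "Inl ` ({u} \<times> S) \<subseteq> ?L" "Inl ` ({r0} \<times> Q0) \<subseteq> ?R"
    using S(1,2) ut r0 by (auto simp: R0_def)
  moreover have "card ?L = m * t + u" "card (Inl ` ({u} \<times> S) :: ((nat \<times> nat) + nat) set) = n"
    using finM A(2) S(4) by (auto simp: card_Plus card_cartesian_product card_image inj_on_def mult.commute)
  ultimately show ?thesis by (intro has_sub_oaI[OF k])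
qed


section \<open>All large orders\<close>

lemma card_bit_poly:
  "finite {p :: bit poly. \<forall>i\<ge>n. coeff p i = 0} \<and> card {p :: bit poly. \<forall>i\<ge>n. coeff p i = 0} = 2 ^ n"
proof (induction n)
  case 0
  have "{p :: bit poly. \<forall>i\<ge>0. coeff p i = 0} = {0}" by (auto simp: poly_eq_iff)
  then show ?case by simp
next
  case (Suc n)
  let ?D = "\<lambda>n. {p :: bit poly. \<forall>i\<ge>n. coeff p i = 0}"
  have img: "?D (Suc n) = (\<lambda>(c, p). pCons c p) ` ({0, 1} \<times> ?D n)"
  proof (intro equalityI subsetI)
    fix p assume p: "p \<in> ?D (Suc n)"
    obtain c q where q: "p = pCons c q" by (cases p)
    have "coeff q i = 0" if "i \<ge> n" for i
      using p that q by (metis (mono_tags, lifting) Suc_le_mono coeff_pCons_Suc mem_Collect_eq)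
    moreover have "c \<in> {0, 1}" by (cases c) auto
    ultimately show "p \<in> (\<lambda>(c, p). pCons c p) ` ({0, 1} \<times> ?D n)"
      using q by (intro image_eqI[of _ _ "(c, q)"]) auto
  next
    fix p assume "p \<in> (\<lambda>(c, p). pCons c p) ` ({0, 1} \<times> ?D n)"
    then show "p \<in> ?D (Suc n)" by (auto simp: coeff_pCons split: nat.split)
  qed
  have "inj_on (\<lambda>(c, p). pCons c p) ({0, 1} \<times> ?D n)" by (auto simp: inj_on_def)
  then have "card (?D (Suc n)) = card ({0 :: bit, 1} \<times> ?D n)" unfolding img by (rule card_image)
  also have "\<dots> = 2 ^ Suc n" using Suc by (simp add: card_cartesian_product)
  finally show ?case using Suc img by simp
qed

lemma range_mod_bit_poly:
  fixes f :: "bit poly"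
  assumes "0 < degree f"
  shows "finite (range (\<lambda>x. x mod f))" "card (range (\<lambda>x. x mod f)) = 2 ^ degree f"
proof -
  have "range (\<lambda>x. x mod f) = {p. \<forall>i\<ge>degree f. coeff p i = 0}"
  proof (intro equalityI subsetI)
    fix p :: "bit poly" assume "p \<in> range (\<lambda>x. x mod f)"
    then obtain x where "p = x mod f" by blast
    moreover have "f \<noteq> 0" using assms by auto
    ultimately have "p = 0 \<or> degree p < degree f" using degree_mod_less[of f x] by blast
    then show "p \<in> {p. \<forall>i\<ge>degree f. coeff p i = 0}" by (auto intro: coeff_eq_0)
  next
    fix p :: "bit poly" assume p: "p \<in> {p. \<forall>i\<ge>degree f. coeff p i = 0}"
    have "degree p < degree f"
    proof (cases "p = 0")
      case False
      then have "coeff p (degree p) \<noteq> 0" by simp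
      then show ?thesis using p by (metis (mono_tags, lifting) linorder_not_le mem_Collect_eq)
    qed (use assms in simp)
    then have "p = p mod f" by (simp add: mod_poly_less)
    then show "p \<in> range (\<lambda>x. x mod f)" by blast
  qed
  then show "finite (range (\<lambda>x. x mod f))" "card (range (\<lambda>x. x mod f)) = 2 ^ degree f"
    using card_bit_poly[of "degree f"] by auto
qed

text \<open>
  No finite field is needed: modulo \<open>f = 1 + X P\<^sup>e\<close>, with \<open>P\<close> the product of the differences of the
  powers \<open>X\<^sup>1, \<dots>, X\<^sup>k\<close>, all these differences are units. The exponent \<open>e\<close> is free because the
  degree of \<open>f\<close> must later be \<open>1\<close> modulo a given number.
\<close>
lemma has_oa_power_of_2:
  assumes "2 \<le> k"
  shows "\<exists>d. \<forall>e>0. has_oa k (2 ^ (1 + e * d))"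
proof -
  define X where "X = (\<lambda>i. monom (1 :: bit) i)"
  define P where "P = (\<Prod>i\<in>{1..k}. \<Prod>j\<in>{1..k} - {i}. X i - X j)"
  have P0: "P \<noteq> 0" unfolding P_def X_def by (simp add: monom_eq_iff')
  have dvdP: "X i - X j dvd P" if "i \<in> {1..k}" "j \<in> {1..k}" "i \<noteq> j" for i j
  proof -
    have "X i - X j dvd (\<Prod>j\<in>{1..k} - {i}. X i - X j)" using that by (intro dvd_prodI) auto
    also have "\<dots> dvd P" unfolding P_def using that by (intro dvd_prodI[of _ _ "\<lambda>i. \<Prod>j\<in>{1..k} - {i}. X i - X j"]) auto
    finally show ?thesis .
  qed
  have "has_oa k (2 ^ (1 + e * degree P))" if e: "e > 0" for e
  proof -
    \<comment> \<open>The factor \<open>X 1\<close> adds \<open>1\<close> to the degree. The order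
      \<open>2 * 2 ^ (e * d)\<close> will thus be \<open>2\<close> modulo an odd \<open>Q\<close>
      when \<open>e\<close> is \<open>totient Q\<close>.\<close>
    define f where "f = 1 + X 1 * P ^ e"
    have d: "degree (X 1 * P ^ e) = 1 + e * degree P"
      using P0 by (simp add: X_def degree_mult_eq degree_power_eq degree_monom_eq)
    then have df: "degree f = 1 + e * degree P"
      unfolding f_def by (subst degree_add_eq_right) auto
    have dv: "f dvd y" if ij: "i \<in> {1..k}" "j \<in> {1..k}" "i \<noteq> j" and y: "f dvd (X i - X j) * y" for i j y
    proof -
      have "X i - X j dvd X 1 * P ^ e"
        using e by (intro dvd_trans[OF dvdP[OF ij]] dvd_mult dvd_power) simp
      then obtain h where h: "X 1 * P ^ e = (X i - X j) * h" by (rule dvdE)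
      \<comment> \<open>\<open>f\<close> is \<open>1\<close> plus a multiple of
        \<open>X i - X j\<close>, so \<open>f * y\<close> is \<open>y\<close> plus a multiple of
        \<open>(X i - X j) * y\<close>.\<close>
      have "f * y = y + h * ((X i - X j) * y)"
        unfolding f_def h by (simp only: distrib_right mult_1) (simp only: ac_simps)
      then have "f dvd y + h * ((X i - X j) * y)" by (metis dvd_triv_left)
      then show ?thesis using dvd_mult[OF y, of h] by (simp only: dvd_add_left_iff)
    qed
    have pos: "0 < degree f" using df by simp
    have "has_oa k (card (range (\<lambda>x. x mod f)))"
      by (rule has_oa_linear[OF assms range_mod_bit_poly(1)[OF pos] dv])
    then show ?thesis by (simp only: range_mod_bit_poly(2)[OF pos] df)
  qed
  then show ?thesis by blast
qed

section \<open>Orders coprime to \<open>k!\<close> and the choice of the multiplier\<close>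

lemma coprime_fact_iff:
  "coprime t (fact k :: nat) \<longleftrightarrow> (\<forall>p. prime p \<longrightarrow> p \<le> k \<longrightarrow> \<not> p dvd t)"
proof
  assume c: "coprime t (fact k :: nat)"
  show "\<forall>p. prime p \<longrightarrow> p \<le> k \<longrightarrow> \<not> p dvd t"
    using coprime_common_divisor[OF c] prime_dvd_fact_iff not_prime_unit by blast
next
  assume a: "\<forall>p. prime p \<longrightarrow> p \<le> k \<longrightarrow> \<not> p dvd t"
  show "coprime t (fact k :: nat)"
  proof (rule ccontr)
    assume "\<not> coprime t (fact k :: nat)"
    then have "gcd t (fact k) \<noteq> 1" using coprime_iff_gcd_eq_1 by blast
    then obtain p where "prime p" "p dvd gcd t (fact k)" using prime_factor_nat by blast
    then show False using a prime_dvd_fact_iff by auto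
  qed
qed

text \<open>Column \<open>i\<close> is \<open>x + i * y\<close> modulo \<open>t\<close>. Differences
  of indices have absolute value from \<open>1\<close> to \<open>k\<close>, so they divide
  \<open>k!\<close> and are units modulo \<open>t\<close>.\<close>

lemma has_oa_coprime_fact:
  assumes "2 \<le> k" "coprime t (fact k)"
  shows "has_oa (k + 1) t"
proof -
  have "\<not> 2 dvd t" using assms by (simp add: coprime_fact_iff)
  then have t: "t \<noteq> 0" by (metis dvd_0_right)
  have r: "range (\<lambda>x. x mod int t) = {0..<int t}"
  proof (intro equalityI subsetI)
    fix x assume "x \<in> {0..<int t}"
    then have "x = x mod int t" by simp
    then show "x \<in> range (\<lambda>x. x mod int t)" by blast
  qed (use t in auto)
  have "has_oa (k + 1) (card (range (\<lambda>x. x mod int t)))"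
  proof (rule has_oa_linear)
    fix i j y assume ij: "i \<in> {1..k+1}" "j \<in> {1..k+1}" "i \<noteq> j" and y: "int t dvd (int i - int j) * y"
    have "nat \<bar>int i - int j\<bar> dvd fact k" using ij by (intro dvd_fact) auto
    then have "coprime t (nat \<bar>int i - int j\<bar>)" using assms(2) by (meson coprime_divisors dvd_refl)
    then have "coprime (int t) (int i - int j)"
      by (metis coprime_abs_right_iff coprime_int_iff int_nat_eq abs_ge_zero)
    then show "int t dvd y" using y by (simp add: coprime_dvd_mult_right_iff)
  qed (use assms r in auto)
  then show ?thesis by (simp add: r)
qed

lemma has_oa_drop_column:
  assumes k: "2 \<le> k" and o: "has_oa (k + 1) N"
  shows "has_oa k N"
proof -
  obtain L :: "nat set" and R :: "nat set" and A where "oa (k + 1) L R A" "card L = N"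
    using o unfolding has_sub_oa_def by blast
  then show ?thesis by (intro has_oaI[OF k, of L R A]) (auto simp: oa_def)
qed

text \<open>\<open>m + 1\<close> is a power of two and, by Euler's theorem, \<open>2\<close> modulo
  the product \<open>Q\<close> of the odd primes up to \<open>k\<close>. Hence \<open>m\<close> is
  \<open>1\<close> modulo all primes up to \<open>k\<close>, is coprime to \<open>k!\<close>, and
  has a linear array.\<close>

lemma exists_multiplier:
  assumes k: "2 \<le> k"
  obtains m where "has_oa k m" "has_oa k (m + 1)" "odd m"
    "\<And>p. prime p \<Longrightarrow> p \<le> k \<Longrightarrow> [m = 1] (mod p)"
proof -
  obtain d where d: "\<And>e. e > 0 \<Longrightarrow> has_oa k (2 ^ (1 + e * d))" using has_oa_power_of_2[OF k] by blast
  define Q where "Q = (\<Prod>p\<in>{p. prime p \<and> p \<le> k \<and> p \<noteq> 2}. p)"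
  have "odd Q" unfolding Q_def
    using primes_dvd_imp_eq[OF two_is_prime_nat] by (subst even_prod_iff) fastforce+
  then have cop: "coprime 2 Q" by simp
  have Q0: "Q > 0" using \<open>odd Q\<close> by (cases Q) auto
  define m where "m = 2 ^ (1 + totient Q * d) - (1 :: nat)"
  have m1: "m + 1 = 2 ^ (1 + totient Q * d)" by (simp add: m_def)
  then have "even (m + 1)" by simp
  then have odd: "odd m" by simp
  have "[2 ^ (totient Q * d) = 1 ^ d] (mod Q)"
    unfolding power_mult by (intro cong_pow euler_theorem cop)
  then have "[2 * 2 ^ (totient Q * d) = 2 * 1] (mod Q)" by (intro cong_mult) auto
  then have "[m + 1 = 1 + 1] (mod Q)" by (simp only: m1 power_add power_one_right mult_2 one_add_one mult_1_right)
  then have mQ: "[m = 1] (mod Q)" by (simp only: cong_add_rcancel_nat)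
  have mp: "[m = 1] (mod p)" if p: "prime p" "p \<le> k" for p
  proof (cases "p = 2")
    case True
    then show ?thesis using odd by (simp add: cong_def odd_iff_mod_2_eq_one)
  next
    case False
    then have "p dvd Q" unfolding Q_def using p
      by (intro dvd_prodI[of _ _ "\<lambda>x. x"]) (auto intro: finite_subset[of _ "{..k}"])
    with mQ show ?thesis by (rule cong_dvd_modulus_nat)
  qed
  have "coprime m (fact k)"
    unfolding coprime_fact_iff
  proof (intro allI impI notI)
    fix p assume p: "prime p" "p \<le> k" "p dvd m"
    have "[m = 0] (mod p)" using p(3) by (simp only: cong_0_iff)
    with cong_sym[OF mp[OF p(1,2)]] have "[1 = 0] (mod p)" by (rule cong_trans)
    then have "p dvd 1" by (simp only: cong_0_iff)
    then show False using p(1) not_prime_unit by blast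
  qed
  then have "has_oa (k + 1) m" by (rule has_oa_coprime_fact[OF k])
  then have "has_oa k m" by (rule has_oa_drop_column[OF k])
  moreover have "has_oa k (m + 1)" unfolding m1 by (rule d) (use Q0 in simp)
  ultimately show thesis using odd mp by (rule that)
qed

section \<open>Decomposing a large order as \<open>m * t + u\<close>\<close>

text \<open>The inequalities say that the remainder \<open>N - m * t\<close> is at least
  \<open>U\<close> and below \<open>t\<close>. For large \<open>N\<close> they hold for
  \<open>K\<close> consecutive values of \<open>t\<close>, one in each residue class.\<close>

lemma exists_in_residue_class:
  fixes N K m U c :: nat
  assumes "0 < K" "(m + 1) * (m * K + U) \<le> N"
  obtains t where "[t = c] (mod K)" "m * t + U \<le> N" "N < m * t + t"
proof -
  \<comment> \<open>\<open>q + 1\<close> is the least \<open>t\<close> with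
    \<open>N < m * t + t\<close>.\<close>
  define q where "q = N div (m + 1)"
  have "N = q * (m + 1) + N mod (m + 1)" "N mod (m + 1) < m + 1"
    unfolding q_def by (simp_all only: div_mult_mod_eq) simp
  then have q: "q * (m + 1) \<le> N" "N < (q + 1) * (m + 1)"
    by (simp_all only: add_mult_distrib mult_1)
  have qU: "m * K + U \<le> q"
    unfolding q_def using assms(2) by (subst less_eq_div_iff_mult_less_eq) (simp_all add: mult.commute)
  \<comment> \<open>The shift below \<open>K\<close> from \<open>q + 1\<close> to the class of
    \<open>c\<close>, taken in the integers because \<open>c - (q + 1)\<close> may be
    negative.\<close>
  define x where "x = nat ((int c - int (q + 1)) mod int K)"
  have x: "x < K" using assms(1) by (simp add: x_def nat_less_iff)
  have "int x = (int c - int (q + 1)) mod int K" using assms(1) by (simp add: x_def)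
  then have "[int x = int c - int (q + 1)] (mod int K)" by (simp add: cong_def)
  then have "[int (q + 1) + int x = int (q + 1) + (int c - int (q + 1))] (mod int K)"
    by (intro cong_add) auto
  then have "[int (q + 1 + x) = int c] (mod int K)" by (simp add: add.assoc)
  then have "[q + 1 + x = c] (mod K)" by (simp only: cong_int_iff)
  moreover have "m * (q + 1 + x) + U \<le> N"
  proof -
    have "m * (q + 1 + x) \<le> m * (q + K)" using x by (intro mult_left_mono) auto
    then have "m * (q + 1 + x) + U \<le> m * q + (m * K + U)" by (simp add: algebra_simps)
    also have "\<dots> \<le> q * (m + 1)" using qU by (simp add: algebra_simps)
    finally show ?thesis using q(1) by simp
  qed
  moreover have "N < m * (q + 1 + x) + (q + 1 + x)"
  proof -
    have "(q + 1) * (m + 1) \<le> (q + 1 + x) * (m + 1)" by (intro mult_right_mono) auto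
    then show ?thesis using q(2) by (simp add: algebra_simps)
  qed
  ultimately show thesis by (rule that)
qed

lemma dvd_cong_iff:
  fixes p :: nat
  assumes "[a = b] (mod K)" "p dvd K"
  shows "p dvd a \<longleftrightarrow> p dvd b"
  by (rule cong_dvd_iff[OF cong_dvd_modulus_nat[OF assms]])

text \<open>For even \<open>N\<close>, congruences give \<open>m * t + u = N\<close> with
  \<open>t\<close> and \<open>u\<close> coprime to \<open>k!\<close>. As \<open>m\<close> is odd,
  such \<open>t\<close> and \<open>u\<close> are odd and only even sums arise; for odd
  \<open>N\<close>, \<open>u\<close> is instead an even order already settled.\<close>

lemma Chowla_Erdos_Straus:
  assumes k: "2 \<le> k"
  shows "\<exists>N0. \<forall>N\<ge>N0. has_oa k N"
proof -
  obtain m where m: "has_oa k m" "has_oa k (m + 1)" "odd m"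
    and mp: "\<And>p. prime p \<Longrightarrow> p \<le> k \<Longrightarrow> [m = 1] (mod p)"
    using exists_multiplier[OF k] by blast
  let ?K = "fact k :: nat"
  have K: "0 < ?K" by simp
  have pK: "p dvd ?K" if "prime p" "p \<le> k" for p using that by (simp add: prime_dvd_fact_iff)
  have Wilson: "has_oa k N"
    if "coprime t ?K" "m * t + u = N" "N < m * t + t" "has_oa k u" for N t u
    using has_oa_Wilson[OF k m(1,2) has_oa_coprime_fact[OF k that(1)] that(4)] that(2,3) by auto
  define N1 where "N1 = (m + 1) * (m * ?K + 0)"
  have even_case: "has_oa k N" if N: "N \<ge> N1" "even N" for N
  proof -
    \<comment> \<open>Each prime up to \<open>k\<close> divides exactly one of \<open>D\<close> and
      \<open>N\<close>.\<close>
    define D where "D = (\<Prod>p\<in>{p. prime p \<and> p \<le> k \<and> \<not> p dvd N}. p)"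
    have D: "p dvd D \<longleftrightarrow> \<not> p dvd N" if p: "prime p" "p \<le> k" for p
    proof
      assume "p dvd D"
      then obtain q where "prime q" "\<not> q dvd N" "p dvd q"
        unfolding D_def using p(1)
        by (subst (asm) prime_dvd_prod_iff) (auto intro: finite_subset[of _ "{..k}"])
      then show "\<not> p dvd N" using p(1) primes_dvd_imp_eq by blast
    next
      assume "\<not> p dvd N"
      then show "p dvd D"
        unfolding D_def using p by (intro dvd_prodI[of _ _ "\<lambda>x. x"]) (auto intro: finite_subset[of _ "{..k}"])
    qed
    text \<open>
      The residue is that of \<open>D - N\<close>. Modulo a prime \<open>p \<le> k\<close>, \<open>u\<close> is \<open>N - t\<close>; so the pair \<open>(t, u)\<close> is
      congruent to \<open>(D, -D)\<close> when \<open>p\<close> divides \<open>N\<close> and to \<open>(-N, 2N)\<close> otherwise.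
    \<close>
    obtain t where t: "[t = D + (?K - 1) * N] (mod ?K)" "m * t + 0 \<le> N" "N < m * t + t"
      using exists_in_residue_class[OF K, of m 0 N "D + (?K - 1) * N"] N(1) unfolding N1_def by blast
    \<comment> \<open>\<open>?K - 1\<close> stands for \<open>-1\<close> modulo \<open>?K\<close>,
      so adding \<open>N\<close> leaves \<open>D\<close>.\<close>
    have "[t + N = D + (?K - 1) * N + N] (mod ?K)" using t(1) by (simp add: cong_add_rcancel_nat)
    also have "D + (?K - 1) * N + N = D + ?K * N" using K by (cases ?K) (simp_all add: algebra_simps)
    also have "[D + ?K * N = D] (mod ?K)" by (simp add: cong_def)
    finally have tN: "[t + N = D] (mod ?K)" .
    have tND: "p dvd t + N \<longleftrightarrow> \<not> p dvd N" if "prime p" "p \<le> k" for p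
      using dvd_cong_iff[OF tN pK[OF that]] D[OF that] by simp
    have ct: "\<not> p dvd t" if p: "prime p" "p \<le> k" for p
      using tND[OF p] by (metis dvd_add dvd_add_right_iff)
    define u where "u = N - m * t"
    have u: "m * t + u = N" using t(2) by (simp add: u_def)
    have cu: "\<not> p dvd u" if p: "prime p" "p \<le> k" for p
    proof
      assume pu: "p dvd u"
      have "[m * t + u = 1 * t + u] (mod p)" using mp[OF p] by (intro cong_add cong_mult) auto
      then have "[N = t + u] (mod p)" using u by simp
      then have "p dvd t \<longleftrightarrow> p dvd N"
        using pu by (simp add: cong_dvd_iff dvd_add_left_iff)
      then have pN: "\<not> p dvd N" using ct[OF p] by simp
      then have "p dvd t + N" using tND[OF p] by simp
      \<comment> \<open>Modulo \<open>p\<close>, \<open>t + N\<close> is \<open>2 * t + u\<close>.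
        This leaves only \<open>p = 2\<close>, which is excluded because \<open>N\<close> is
        even.\<close>
      moreover have "[t + N = t + (t + u)] (mod p)" using \<open>[N = t + u] (mod p)\<close> by (intro cong_add) auto
      ultimately have "p dvd t + (t + u)" by (simp only: cong_dvd_iff)
      then have "p dvd 2 * t" using pu by (simp only: mult_2 add.assoc[symmetric] dvd_add_left_iff)
      then have "p dvd 2" using p(1) ct[OF p] by (simp only: prime_dvd_mult_iff) simp
      then have "p = 2" using p(1) by (simp add: primes_dvd_imp_eq)
      then show False using pN N(2) by simp
    qed
    have "has_oa (k + 1) u" by (rule has_oa_coprime_fact[OF k]) (use cu in \<open>simp add: coprime_fact_iff\<close>)
    then have "has_oa k u" by (rule has_oa_drop_column[OF k])
    moreover have "coprime t ?K" using ct by (simp add: coprime_fact_iff)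
    ultimately show ?thesis using Wilson u t(3) by blast
  qed
  have odd_case: "has_oa k N" if N: "N \<ge> (m + 1) * (m * ?K + N1)" "odd N" for N
  proof -
    \<comment> \<open>Being \<open>1\<close> modulo \<open>k!\<close>, \<open>t\<close> is odd, so
      the remainder is even; the reserve \<open>N1\<close> makes it large enough for the even
      case.\<close>
    obtain t where t: "[t = 1] (mod ?K)" "m * t + N1 \<le> N" "N < m * t + t"
      by (rule exists_in_residue_class[OF K N(1)])
    have ct: "coprime t ?K" using t(1) by (metis cong_imp_coprime cong_sym coprime_1_left)
    then have "odd t" using k by (simp add: coprime_fact_iff)
    have "even (N - m * t)" using N(2) m(3) \<open>odd t\<close> t(2) by simp
    then have "has_oa k (N - m * t)" using t(2) by (intro even_case) auto
    then show ?thesis using Wilson[OF ct, of "N - m * t" N] t by simp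
  qed
  show ?thesis
  proof (intro exI allI impI)
    fix N assume "N \<ge> N1 + (m + 1) * (m * ?K + N1)"
    then show "has_oa k N" using even_case odd_case by (cases "even N") auto
  qed
qed

text \<open>The multiplier now contains an \<open>OA(k,n)\<close>. With all large orders available,
  \<open>t\<close> can be \<open>1\<close> modulo \<open>k!\<close> and the remainder only has to
  reach \<open>N1\<close>.\<close>

lemma eventually_has_sub_oa:
  assumes k: "2 \<le> k" and n: "has_oa k n" "0 < n"
  shows "\<exists>N0. \<forall>N\<ge>N0. has_sub_oa k N n"
proof -
  obtain N1 where N1: "\<And>N. N \<ge> N1 \<Longrightarrow> has_oa k N" using Chowla_Erdos_Straus[OF k] by blast
  \<comment> \<open>Both \<open>s\<close> and \<open>n * s + 1\<close> are then at least
    \<open>N1\<close>, and \<open>s\<close> is positive, as the product needs.\<close>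
  define s where "s = N1 + 1"
  define m where "m = n * s"
  have "has_sub_oa k m n"
    unfolding m_def by (rule has_sub_oa_product[OF k N1 n(1)]) (simp_all add: s_def)
  moreover have "N1 \<le> m + 1"
  proof -
    have "1 * s \<le> n * s" using n(2) by (intro mult_right_mono) auto
    then show ?thesis by (simp add: m_def s_def)
  qed
  then have "has_oa k (m + 1)" by (rule N1)
  moreover have "\<exists>t u. has_oa (k + 1) t \<and> has_oa k u \<and> u < t \<and> m * t + u = N"
    if N: "N \<ge> (m + 1) * (m * fact k + N1)" for N
  proof -
    obtain t where t: "[t = 1] (mod fact k)" "m * t + N1 \<le> N" "N < m * t + t"
      by (rule exists_in_residue_class[OF _ N]) auto
    have "coprime t (fact k)" using t(1) by (metis cong_imp_coprime cong_sym coprime_1_left)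
    then have "has_oa (k + 1) t" by (rule has_oa_coprime_fact[OF k])
    moreover have "has_oa k (N - m * t)" using t(2) by (intro N1) auto
    ultimately show ?thesis using t(2,3) by (intro exI[of _ t] exI[of _ "N - m * t"]) auto
  qed
  ultimately show ?thesis using has_oa_Wilson[OF k, of m n] by blast
qed

text \<open>Needed to draw an \<open>OA(k,n)\<close> from the hypothesis of the theorem, which
  speaks only of plausible vectors. In the cyclic sum of the witness, each of the three pairs of
  indices contributes \<open>?b\<close> once, from its larger member, and \<open>3 * ?b\<close> is
  \<open>?b\<close>.\<close>

lemma plausible_exists: "\<exists>t. plausible k n t"
proof
  let ?b = "of_nat (n choose 2) :: bit"
  have lt: "of_bool (x < y) + of_bool (y < x) = (1 :: bit)" if "x \<noteq> y" for x y :: nat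
    using that by (cases "x < y") simp_all
  show "plausible k n (\<lambda>c i j. ?b * (of_bool (i < c) + of_bool (j < c)))"
    unfolding plausible_def
  proof (intro conjI ballI impI)
    fix c i j l :: nat
    show "?b * (of_bool (i < c) + of_bool (j < c)) = ?b * (of_bool (j < c) + of_bool (i < c))"
      by (simp only: add.commute)
    show "?b * (of_bool (i < c) + of_bool (j < c)) =
        ?b * (of_bool (i < c) + of_bool (l < c)) + ?b * (of_bool (l < c) + of_bool (j < c))"
      by (simp only: distrib_left ac_simps bit_add_left_self bit_add_self add_0_left add_0_right)
    assume "distinct [c, i, j]"
    then have "(of_bool (i < c) + of_bool (c < i)) + (of_bool (j < c) + of_bool (c < j)) +
        (of_bool (i < j) + of_bool (j < i)) = 1 + 1 + (1 :: bit)"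
      using lt[of i c] lt[of j c] lt[of i j] by simp
    then have "?b * ((of_bool (i < c) + of_bool (c < i)) + (of_bool (j < c) + of_bool (c < j)) +
        (of_bool (i < j) + of_bool (j < i))) = ?b"
      by (simp only: bit_add_self add_0_left mult_1_right)
    then show "?b * (of_bool (i < c) + of_bool (j < c)) + ?b * (of_bool (c < i) + of_bool (j < i)) +
        ?b * (of_bool (c < j) + of_bool (i < j)) = ?b"
      by (simp only: distrib_left ac_simps)
  qed
qed

theorem corollary4p8:
  fixes k n :: nat
  assumes "n \<ge> 2" and "3 \<le> k" and "k \<le> n + 1"
    and "\<forall>t. plausible k n t \<longrightarrow> actual k n t"
  shows "\<exists>N0. \<forall>N\<ge>N0. \<forall>t. plausible k N t \<longrightarrow> actual k N t"
proof -
  have k: "2 \<le> k" using assms(2) by simp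
  obtain t where "plausible k n t" using plausible_exists by blast
  then obtain L :: "nat set" and A where "orthogonal_array k n L A"
    using assms(4) unfolding actual_def by blast
  then have "card L = n" "oa k L {1..n^2} A" by (simp_all add: orthogonal_array_iff_oa[OF k])
  then have "has_oa k n" by (intro has_oaI[OF k])
  then obtain N0 where "\<And>N. N \<ge> N0 \<Longrightarrow> has_sub_oa k N n"
    using eventually_has_sub_oa[OF k] assms(1) by (metis less_le_trans zero_less_numeral)
  then show ?thesis using actual_of_sub_oa[OF k] assms(4) by blast
qed

end
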